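(* The following two decision problems are both undecidable. (1) Given (by a finite neighborhood $N\subset\mathbb{Z}^2$ and a local rule $F:\{0,1\}^N\to\{0,1\}$) a freezing cellular automaton $f$ on $\{0,1\}^{\mathbb{Z}^2}$, decide whether there exists $p$ with $0<p<1$ such that $f$ trivializes the Bernoulli measure $\mu_p$. (2) Given (in the same way) a freezing cellular automaton $f$ on $\{0,1\}^{\mathbb{Z}^2}$, decide whether $f$ trivializes $\mu_p$ for all $p$ with $0<p<1$.
   Context: A cellular automaton (CA) on $A^{\mathbb{Z}^d}$ ($A$ a finite alphabet) is a map $f:A^{\mathbb{Z}^d}\to A^{\mathbb{Z}^d}$ for which there are a finite neighborhood $N\subset\mathbb{Z}^d$ and a local rule $F:A^N\to A$ with $f(x)_{\vec v}=F\big((x_{\vec v+\vec n})_{\vec n\in N}\big)$ for all $x\in A^{\mathbb{Z}^d}$ and $\vec v\in\mathbb{Z}^d$. The set $A^{\mathbb{Z}^d}$ carries the prodiscrete topology. On $\{0,1\}^{\mathbb{Z}^2}$ use the cellwise order induced by $0<1$; a CA $f$ is freezing if $x\le f(x)$ for all $x$. For $0\le p\le 1$, $\mu_p$ is the Bernoulli (i.i.d. product) measure on $\{0,1\}^{\mathbb{Z}^2}$ in which each cell is $1$ with probability $p$. For a Borel probability measure $\mu$ on $A^{\mathbb{Z}^d}$ and a CA $f$, put $f(\mu)(X)=\mu(f^{-1}(X))$. Borel probability measures are given the weak-$*$ topology (convergence on cylinder sets). The support $\mathrm{Supp}(\nu)$ is the smallest closed set of full $\nu$-measure. The $\mu$-limit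 set of $f$ is $\Omega_f^\mu=\overline{\bigcup_{\nu\in\mathcal{F}}\mathrm{Supp}(\nu)}$, where $\mathcal{F}$ is the set of limit points of the sequence $(f^n(\mu))_{n\in\mathbb{N}}$. We say $f$ trivializes $\mu$ if $|\Omega_f^\mu|=1$. *)

theory Defs
  imports "HOL-Probability.Probability" "HOL-Library.Nat_Bijection"
begin

type_synonym cell = "int \<times> int"

text \<open>The symbols \<open>0 < 1\<close> are \<^term>\<open>False < True\<close>; the topology and the order on configurations are
  the product topology and the pointwise order of the library's function type.\<close>
type_synonym config = "cell \<Rightarrow> bool"

text \<open>A local rule \<open>F : {0,1}\<^sup>N \<rightarrow> {0,1}\<close> is only ever applied to elements of
  \<^term>\<open>N \<rightarrow>\<^sub>E (UNIV :: bool set)\<close>; its values elsewhere are irrelevant.\<close>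
definition ca_map :: "cell set \<Rightarrow> (config \<Rightarrow> bool) \<Rightarrow> config \<Rightarrow> config" where
  "ca_map N F x = (\<lambda>v. F (\<lambda>n\<in>N. x (v + n)))"

definition freezing :: "(config \<Rightarrow> config) \<Rightarrow> bool" where
  "freezing f \<longleftrightarrow> (\<forall>x. x \<le> f x)"

definition bernoulli :: "real \<Rightarrow> config measure" where
  "bernoulli p = Pi\<^sub>M UNIV (\<lambda>_. measure_pmf (bernoulli_pmf p))"

definition cylinder :: "cell set \<Rightarrow> config \<Rightarrow> config set" where
  "cylinder D u = {x. \<forall>v\<in>D. x v = u v}"

definition weak_conv_config :: "(nat \<Rightarrow> config measure) \<Rightarrow> config measure \<Rightarrow> bool" where
  "weak_conv_config M \<nu> \<longleftrightarrow>
     (\<forall>D u. finite D \<longrightarrow> (\<lambda>n. measure (M n) (cylinder D u)) \<longlonglongrightarrow> measure \<nu> (cylinder D u))"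

text \<open>The weak-* topology on the Borel probability measures is metrizable, so that the limit points
  of a sequence are the limits of its subsequences.\<close>
definition limit_measures :: "(nat \<Rightarrow> config measure) \<Rightarrow> config measure set" where
  "limit_measures M =
     {\<nu>. prob_space \<nu> \<and> sets \<nu> = sets borel \<and>
         (\<exists>r::nat \<Rightarrow> nat. strict_mono r \<and> weak_conv_config (M \<circ> r) \<nu>)}"

text \<open>The configuration space is second countable, so this intersection has itself full measure.\<close>
definition supp :: "config measure \<Rightarrow> config set" where
  "supp \<nu> = \<Inter>{C. closed C \<and> measure \<nu> C = 1}"

definition mu_limit_set :: "config measure \<Rightarrow> (config \<Rightarrow> config) \<Rightarrow> config set" where
  "mu_limit_set \<mu> f = closure (\<Union>\<nu>\<in>limit_measures (\<lambda>n. distr \<mu> borel (f ^^ n)). supp \<nu>)"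

definition trivializes :: "(config \<Rightarrow> config) \<Rightarrow> config measure \<Rightarrow> bool" where
  "trivializes f \<mu> \<longleftrightarrow> card (mu_limit_set \<mu> f) = 1"

text \<open>Partial recursive functions. Terms carry no arity: a term denotes a partial function on lists of every length,
  undefined where no rule applies.\<close>
datatype recf =
    Zero
  | Succ
  | Proj nat
  | Comp recf "recf list"
  | PrimRec recf recf
  | Mu recf

inductive eval :: "recf \<Rightarrow> nat list \<Rightarrow> nat \<Rightarrow> bool" where
  zero: "eval Zero xs 0"
| succ: "eval Succ [x] (Suc x)"
| proj: "i < length xs \<Longrightarrow> eval (Proj i) xs (xs ! i)"
| comp: "list_all2 (\<lambda>g y. eval g xs y) gs ys \<Longrightarrow> eval f ys z \<Longrightarrow> eval (Comp f gs) xs z"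
| prim_0: "eval f xs z \<Longrightarrow> eval (PrimRec f g) (0 # xs) z"
| prim_Suc: "eval (PrimRec f g) (n # xs) y \<Longrightarrow> eval g (n # y # xs) z \<Longrightarrow>
    eval (PrimRec f g) (Suc n # xs) z"
| mu: "eval f (n # xs) 0 \<Longrightarrow> (\<And>m. m < n \<Longrightarrow> \<exists>y>0. eval f (m # xs) y) \<Longrightarrow> eval (Mu f) xs n"

text \<open>The problem ``given an instance \<open>i\<close> with \<open>P i\<close>, decide \<open>Q i\<close>'': an algorithm receives the code
  of \<open>i\<close>, and nothing is required of it on other inputs.\<close>
definition decidable_given :: "('i \<Rightarrow> nat) \<Rightarrow> ('i \<Rightarrow> bool) \<Rightarrow> ('i \<Rightarrow> bool) \<Rightarrow> bool" where
  "decidable_given code P Q \<longleftrightarrow>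
     (\<exists>r. \<forall>i. P i \<longrightarrow> eval r [code i] (if Q i then 1 else 0))"

text \<open>Finite sets are given by their canonical indices (\<^term>\<open>set_encode\<close>), a pattern
  \<open>p \<in> {0,1}\<^sup>N\<close> by the set of cells at which it is \<open>1\<close>, and a local rule by the set of patterns that
  it maps to \<open>1\<close>.\<close>
definition cells_code :: "cell set \<Rightarrow> nat" where
  "cells_code D = set_encode ((\<lambda>(a, b). prod_encode (int_encode a, int_encode b)) ` D)"

definition ca_code :: "cell set \<times> (config \<Rightarrow> bool) \<Rightarrow> nat" where
  "ca_code = (\<lambda>(N, F). prod_encode (cells_code N,
     set_encode ((\<lambda>p. cells_code {n \<in> N. p n}) ` {p \<in> N \<rightarrow>\<^sub>E UNIV. F p})))"

end

theory Submission
  imports Defs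
begin

text \<open>
Both problems are undecidable because one computable family of freezing automata \<open>f m\<close> settles them at once:
a member of the family either trivializes \<open>\<mu>\<^sub>p\<close> for every \<open>0 < p < 1\<close> or for no such \<open>p\<close>, and which of
the two happens encodes the outcome of a computation on the input \<open>m\<close>.

In \<open>f m\<close> a cell in state 0 survives only as long as it lies in a horizontal code word of a tile whose four
neighbours are code words of matching tiles; otherwise it becomes 1. The tiles describe the space-time diagram of
a counter machine inside a rectangular frame: a row is a configuration with the counters written in unary, the
bottom row holds the input \<open>m\<close>, and the top row must be an accepting configuration.

If the machine accepts, then the encoded rectangle is a finite pattern that protects itself against every
surrounding. It occurs at the origin with positive probability, so that the origin stays 0 with positive
probability, whereas it is 1 from the start with probability \<open>p\<close>: the limit measure has at least two points in
its support (\<open>tiling_stable\<close>, \<open>not_trivializes_if_stable_pattern\<close>).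

If the machine does not accept, consider the pointwise limit \<open>x\<close> of the orbit, which is a fixed point.
Almost surely every arithmetic progression of cells contains a 1. A 0 in \<open>x\<close> would lie in a tile; following its
row and then its column, one cannot continue through tiles forever, so that one meets the frame in all four
directions, and the frame bounds an accepting space-time diagram, a contradiction
(\<open>tiling_of_fixed_point\<close>). Hence \<open>x\<close> is constantly 1 and \<open>\<mu>\<^sub>p\<close> is trivialized (\<open>trivializes_if_AE_ones\<close>).

The undecidability follows by diagonalization. Let \<open>r\<close> decide one of the problems. The map that sends \<open>m\<close>
to the code of the automaton with tile set and input both read off from \<open>m\<close> is computable
(\<open>total_rec_ca_code\<close>); call it \<open>g\<close>. Compile \<open>r \<circ> g\<close> into a counter machine that accepts
when the answer is ``yes'' (\<open>compile_correct\<close>), and let \<open>m\<close> be the code of its tile set. The automaton of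
\<open>m\<close> trivializes the Bernoulli measures exactly if \<open>r\<close> answers ``no'' about it.
\<close>

section \<open>Computing the code of an automaton\<close>

text \<open>The variables of an expression are the entries \<open>xs ! i\<close> of an environment \<open>xs\<close>. An operator that binds a
variable, such as a bounded sum, pushes its value on the front, so that inside it the surrounding variables are
\<open>tl xs ! i\<close>. With this convention the closure rules below can be applied by \<open>intro\<close> to a closed
expression.\<close>

definition total_rec :: "nat \<Rightarrow> (nat list \<Rightarrow> nat) \<Rightarrow> bool" where
  "total_rec n f \<longleftrightarrow> (\<exists>r. \<forall>xs. length xs = n \<longrightarrow> eval r xs (f xs))"

definition dec_rec :: "nat \<Rightarrow> (nat list \<Rightarrow> bool) \<Rightarrow> bool" where
  "dec_rec n P \<longleftrightarrow> total_rec n (\<lambda>xs. of_bool (P xs))"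

lemma total_rec_cong:
  assumes "total_rec n f" "\<And>xs. length xs = n \<Longrightarrow> g xs = f xs"
  shows "total_rec n g"
  using assms unfolding total_rec_def by auto

lemma total_rec_proj: "i < n \<Longrightarrow> total_rec n (\<lambda>xs. xs ! i)"
  unfolding total_rec_def by (auto intro!: exI[of _ "Proj i"] proj)

lemma total_rec_comp:
  assumes "total_rec (length fs) h" "\<forall>f\<in>set fs. total_rec n f"
  shows "total_rec n (\<lambda>xs. h (map (\<lambda>f. f xs) fs))"
proof -
  obtain rh where rh: "\<And>ys. length ys = length fs \<Longrightarrow> eval rh ys (h ys)"
    using assms(1) unfolding total_rec_def by auto
  obtain R where R: "\<And>f xs. f \<in> set fs \<Longrightarrow> length xs = n \<Longrightarrow> eval (R f) xs (f xs)"
    using assms(2) unfolding total_rec_def by metis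
  show ?thesis unfolding total_rec_def
    by (rule exI[of _ "Comp rh (map R fs)"])
      (auto intro!: comp[where ys = "map (\<lambda>f. f _) fs"] rh R simp: list_all2_conv_all_nth)
qed

lemma total_rec_comp1:
  assumes "total_rec 1 (\<lambda>ys. h (ys ! 0))" "total_rec n f"
  shows "total_rec n (\<lambda>xs. h (f xs))"
  using total_rec_comp[of "[f]" "\<lambda>ys. h (ys ! 0)" n] assms by simp

lemma total_rec_Suc:
  assumes "total_rec n f" shows "total_rec n (\<lambda>xs. Suc (f xs))"
proof (rule total_rec_comp1[OF _ assms])
  show "total_rec 1 (\<lambda>ys. Suc (ys ! 0))"
    unfolding total_rec_def by (rule exI[of _ Succ]) (auto simp: length_Suc_conv intro: succ)
qed

lemma total_rec_const: "total_rec n (\<lambda>xs. c)"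
proof (induction c)
  case 0
  then show ?case unfolding total_rec_def by (auto intro: zero)
qed (rule total_rec_Suc)

lemma total_rec_tl:
  assumes "total_rec n f" shows "total_rec (Suc n) (\<lambda>xs. f (tl xs))"
proof -
  have "total_rec (Suc n) (\<lambda>xs. f (map (\<lambda>g. g xs) (map (\<lambda>i xs. xs ! Suc i) [0..<n])))"
    by (rule total_rec_comp) (auto intro: total_rec_proj assms)
  then show ?thesis
  proof (rule total_rec_cong)
    fix xs :: "nat list" assume "length xs = Suc n"
    then have "map (\<lambda>g. g xs) (map (\<lambda>i xs. xs ! Suc i) [0..<n]) = tl xs"
      by (auto intro!: nth_equalityI simp: nth_tl)
    then show "f (tl xs) = f (map (\<lambda>g. g xs) (map (\<lambda>i xs. xs ! Suc i) [0..<n]))" by simp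
  qed
qed

text \<open>Variables seen through up to five binders.\<close>

lemma total_rec_nth_tl:
  "Suc i < n \<Longrightarrow> total_rec n (\<lambda>xs. tl xs ! i)"
  "Suc (Suc i) < n \<Longrightarrow> total_rec n (\<lambda>xs. tl (tl xs) ! i)"
  "Suc (Suc (Suc i)) < n \<Longrightarrow> total_rec n (\<lambda>xs. tl (tl (tl xs)) ! i)"
  "Suc (Suc (Suc (Suc i))) < n \<Longrightarrow> total_rec n (\<lambda>xs. tl (tl (tl (tl xs))) ! i)"
  "Suc (Suc (Suc (Suc (Suc i)))) < n \<Longrightarrow> total_rec n (\<lambda>xs. tl (tl (tl (tl (tl xs)))) ! i)"
  by (rule total_rec_cong[OF total_rec_proj]; simp add: nth_tl)+

lemma total_rec_rec_nat:
  assumes a: "total_rec n a" and h: "total_rec (Suc (Suc n)) (\<lambda>ys. h (ys ! 0) (ys ! 1) (tl (tl ys)))"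
    and b: "total_rec n b"
  shows "total_rec n (\<lambda>xs. rec_nat (a xs) (\<lambda>i y. h i y xs) (b xs))"
proof -
  obtain ra where ra: "\<And>xs. length xs = n \<Longrightarrow> eval ra xs (a xs)"
    using a unfolding total_rec_def by auto
  obtain rh where rh: "\<And>ys. length ys = Suc (Suc n) \<Longrightarrow> eval rh ys (h (ys ! 0) (ys ! 1) (tl (tl ys)))"
    using h unfolding total_rec_def by auto
  have *: "eval (PrimRec ra rh) (m # xs) (rec_nat (a xs) (\<lambda>i y. h i y xs) m)"
    if "length xs = n" for m xs
  proof (induction m)
    case 0
    show ?case using that by (auto intro: prim_0 ra)
  next
    case (Suc m)
    show ?case using rh[of "m # rec_nat (a xs) (\<lambda>i y. h i y xs) m # xs"] that
      by (auto intro: prim_Suc[OF Suc])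
  qed
  let ?R = "\<lambda>ys. rec_nat (a (tl ys)) (\<lambda>i y. h i y (tl ys)) (ys ! 0)"
  let ?fs = "b # map (\<lambda>i xs. xs ! i) [0..<n]"
  have "total_rec (length ?fs) ?R" unfolding total_rec_def
    by (rule exI[of _ "PrimRec ra rh"]) (auto simp: length_Suc_conv intro: *)
  then have "total_rec n (\<lambda>xs. ?R (map (\<lambda>f. f xs) ?fs))"
    by (rule total_rec_comp) (auto intro: b total_rec_proj)
  then show ?thesis
  proof (rule total_rec_cong)
    fix xs :: "nat list" assume "length xs = n"
    then have "map (\<lambda>f. f xs) (map (\<lambda>i xs. xs ! i) [0..<n]) = xs"
      by (auto intro!: nth_equalityI)
    then show "rec_nat (a xs) (\<lambda>i y. h i y xs) (b xs) = ?R (map (\<lambda>f. f xs) ?fs)" by simp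
  qed
qed

lemma total_rec_add:
  assumes "total_rec n f" "total_rec n g" shows "total_rec n (\<lambda>xs. f xs + g xs)"
proof -
  have "rec_nat x (\<lambda>i y. Suc y) y = x + y" for x y :: nat by (induction y) auto
  moreover have "total_rec n (\<lambda>xs. rec_nat (f xs) (\<lambda>i y. Suc y) (g xs))"
    by (intro total_rec_rec_nat assms total_rec_Suc total_rec_proj) auto
  ultimately show ?thesis by simp
qed

lemma total_rec_mult:
  assumes "total_rec n f" "total_rec n g" shows "total_rec n (\<lambda>xs. f xs * g xs)"
proof -
  have "rec_nat 0 (\<lambda>i y. y + x) y = x * y" for x y :: nat by (induction y) auto
  moreover have "total_rec n (\<lambda>xs. rec_nat 0 (\<lambda>i y. y + f xs) (g xs))"
    by (intro total_rec_rec_nat[where h = "\<lambda>i y xs. y + f xs"] assms total_rec_add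
      total_rec_const total_rec_proj total_rec_tl) auto
  ultimately show ?thesis by simp
qed

lemma total_rec_power:
  assumes "total_rec n f" "total_rec n g" shows "total_rec n (\<lambda>xs. f xs ^ g xs)"
proof -
  have "rec_nat 1 (\<lambda>i y. y * x) y = x ^ y" for x y :: nat by (induction y) auto
  moreover have "total_rec n (\<lambda>xs. rec_nat 1 (\<lambda>i y. y * f xs) (g xs))"
    by (intro total_rec_rec_nat[where h = "\<lambda>i y xs. y * f xs"] assms total_rec_mult
      total_rec_const total_rec_proj total_rec_tl) auto
  ultimately show ?thesis by simp
qed

lemma total_rec_diff:
  assumes "total_rec n f" "total_rec n g" shows "total_rec n (\<lambda>xs. f xs - g xs)"
proof -
  have pred: "total_rec n (\<lambda>xs. f xs - 1)" if "total_rec n f" for n and f :: "nat list \<Rightarrow> nat"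
  proof -
    have "rec_nat 0 (\<lambda>i y. i) y = y - 1" for y :: nat by (induction y) auto
    moreover have "total_rec n (\<lambda>xs. rec_nat 0 (\<lambda>i y. i) (f xs))"
      by (intro total_rec_rec_nat that total_rec_const total_rec_proj) auto
    ultimately show ?thesis by simp
  qed
  have "rec_nat x (\<lambda>i y. y - 1) y = x - y" for x y :: nat by (induction y) auto
  moreover have "total_rec n (\<lambda>xs. rec_nat (f xs) (\<lambda>i y. y - 1) (g xs))"
    by (intro total_rec_rec_nat assms pred total_rec_proj) auto
  ultimately show ?thesis by simp
qed

lemma total_rec_sum:
  assumes h: "total_rec (Suc n) (\<lambda>ys. h (ys ! 0) (tl ys))" and b: "total_rec n b"
  shows "total_rec n (\<lambda>xs. \<Sum>i<b xs. h i xs)"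
proof -
  obtain rh where rh: "\<And>ys. length ys = Suc n \<Longrightarrow> eval rh ys (h (ys ! 0) (tl ys))"
    using h unfolding total_rec_def by auto
  have "total_rec (Suc (Suc n)) (\<lambda>ys. h (ys ! 0) (tl (tl ys)))"
  proof -
    let ?fs = "(\<lambda>xs. xs ! 0) # map (\<lambda>i xs. xs ! Suc (Suc i)) [0..<n]"
    have "total_rec (Suc (Suc n)) (\<lambda>xs. (\<lambda>ys. h (ys ! 0) (tl ys)) (map (\<lambda>f. f xs) ?fs))"
      by (rule total_rec_comp) (use h in \<open>auto intro: total_rec_proj\<close>)
    then show ?thesis
    proof (rule total_rec_cong)
      fix xs :: "nat list" assume "length xs = Suc (Suc n)"
      then have "map (\<lambda>f. f xs) (map (\<lambda>i xs. xs ! Suc (Suc i)) [0..<n]) = tl (tl xs)"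
        by (auto intro!: nth_equalityI simp: nth_tl)
      then show "h (xs ! 0) (tl (tl xs)) = (\<lambda>ys. h (ys ! 0) (tl ys)) (map (\<lambda>f. f xs) ?fs)" by simp
    qed
  qed
  then have "total_rec n (\<lambda>xs. rec_nat 0 (\<lambda>i y. y + h i xs) (b xs))"
    by (intro total_rec_rec_nat[where h = "\<lambda>i y xs. y + h i xs"] total_rec_add b
      total_rec_const total_rec_proj) auto
  moreover have "rec_nat 0 (\<lambda>i y. y + h i xs) m = (\<Sum>i<m. h i xs)" for m xs by (induction m) auto
  ultimately show ?thesis by simp
qed

lemma dec_rec_le:
  assumes "total_rec n f" "total_rec n g" shows "dec_rec n (\<lambda>xs. f xs \<le> g xs)"
proof -
  have "total_rec n (\<lambda>xs. 1 - (f xs - g xs))"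
    by (intro total_rec_diff total_rec_const assms)
  then show ?thesis unfolding dec_rec_def by (rule total_rec_cong) auto
qed

lemma dec_rec_not: "dec_rec n P \<Longrightarrow> dec_rec n (\<lambda>xs. \<not> P xs)"
  unfolding dec_rec_def
  by (rule total_rec_cong[OF total_rec_diff[OF total_rec_const[of _ 1]]]) auto

lemma dec_rec_conj: "dec_rec n P \<Longrightarrow> dec_rec n Q \<Longrightarrow> dec_rec n (\<lambda>xs. P xs \<and> Q xs)"
  unfolding dec_rec_def by (drule (1) total_rec_mult) (erule total_rec_cong, auto)

lemma dec_rec_disj: "dec_rec n P \<Longrightarrow> dec_rec n Q \<Longrightarrow> dec_rec n (\<lambda>xs. P xs \<or> Q xs)"
  using dec_rec_not[OF dec_rec_conj[OF dec_rec_not dec_rec_not], of n P Q] by simp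

lemma dec_rec_imp: "dec_rec n P \<Longrightarrow> dec_rec n Q \<Longrightarrow> dec_rec n (\<lambda>xs. P xs \<longrightarrow> Q xs)"
  unfolding imp_conv_disj by (intro dec_rec_disj dec_rec_not)

lemma dec_rec_iff: "dec_rec n P \<Longrightarrow> dec_rec n Q \<Longrightarrow> dec_rec n (\<lambda>xs. P xs \<longleftrightarrow> Q xs)"
  unfolding iff_conv_conj_imp by (intro dec_rec_conj dec_rec_imp)

lemma dec_rec_less:
  "total_rec n f \<Longrightarrow> total_rec n g \<Longrightarrow> dec_rec n (\<lambda>xs. f xs < g xs)"
  using dec_rec_not[OF dec_rec_le, of n g f] by (simp add: not_le)

lemma dec_rec_eq:
  "total_rec n f \<Longrightarrow> total_rec n g \<Longrightarrow> dec_rec n (\<lambda>xs. f xs = g xs)"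
  unfolding order.eq_iff by (intro dec_rec_conj dec_rec_le)

lemma dec_rec_Ex:
  assumes "dec_rec (Suc n) (\<lambda>ys. P (ys ! 0) (tl ys))" "total_rec n b"
  shows "dec_rec n (\<lambda>xs. \<exists>i<b xs. P i xs)"
proof -
  have "dec_rec n (\<lambda>xs. 1 \<le> (\<Sum>i<b xs. of_bool (P i xs) :: nat))"
    by (intro dec_rec_le total_rec_const total_rec_sum assms(1)[unfolded dec_rec_def] assms(2))
  moreover have "1 \<le> (\<Sum>i<m. of_bool (P i xs) :: nat) \<longleftrightarrow> (\<exists>i<m. P i xs)" for m xs
    unfolding One_nat_def Suc_le_eq by (subst zero_less_iff_neq_zero, subst sum_eq_0_iff) auto
  ultimately show ?thesis by simp
qed

lemma dec_rec_All:
  assumes "dec_rec (Suc n) (\<lambda>ys. P (ys ! 0) (tl ys))" "total_rec n b"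
  shows "dec_rec n (\<lambda>xs. \<forall>i<b xs. P i xs)"
  using dec_rec_not[OF dec_rec_Ex[OF dec_rec_not[OF assms(1)] assms(2)]] by simp

text \<open>Bit \<open>i\<close> of \<open>c\<close> is 1 if \<open>c\<close> lies between an odd multiple of \<open>2 ^ i\<close> and the next even one; the search
for that multiple is bounded by \<open>c\<close>.\<close>

lemma dec_rec_bit:
  assumes "total_rec n f" "total_rec n g"
  shows "dec_rec n (\<lambda>xs. f xs \<in> set_decode (g xs))"
proof -
  have *: "i \<in> set_decode c \<longleftrightarrow> (\<exists>j<Suc c. (2 * j + 1) * 2 ^ i \<le> c \<and> c < (2 * j + 2) * 2 ^ i)"
    (is "_ \<longleftrightarrow> ?R") for i c :: nat
  proof
    assume "i \<in> set_decode c"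
    then obtain j where j: "c div 2 ^ i = 2 * j + 1" unfolding set_decode_def by (auto elim: oddE)
    have "(2 * j + 1) * 2 ^ i \<le> c" using div_times_less_eq_dividend[of c "2 ^ i"] unfolding j by simp
    moreover have "c < (2 * j + 2) * 2 ^ i"
      using dividend_less_div_times[of "2 ^ i" c] j by (simp add: algebra_simps)
    moreover have "j < Suc c" using j div_le_dividend[of c "2 ^ i"] by linarith
    ultimately show ?R by blast
  next
    assume ?R
    then obtain j where "(2 * j + 1) * 2 ^ i \<le> c" "c < (2 * j + 2) * 2 ^ i" by blast
    then have "c div 2 ^ i = 2 * j + 1"
      by (intro div_nat_eqI) (auto simp: algebra_simps)
    then show "i \<in> set_decode c" unfolding set_decode_def by simp
  qed
  show ?thesis unfolding *
    by (intro dec_rec_Ex dec_rec_conj dec_rec_le dec_rec_less total_rec_Suc total_rec_mult total_rec_add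
      total_rec_const total_rec_power total_rec_proj total_rec_tl assms) auto
qed

lemma total_rec_prod_encode:
  assumes "total_rec n f" "total_rec n g"
  shows "total_rec n (\<lambda>xs. prod_encode (f xs, g xs))"
proof -
  have "triangle m = (\<Sum>i<m. Suc i)" for m by (induction m) auto
  then have *: "prod_encode (a, b) = (\<Sum>i<a + b. Suc i) + a" for a b
    by (simp add: prod_encode_def)
  show ?thesis unfolding *
    by (intro total_rec_add total_rec_sum total_rec_Suc assms total_rec_proj) auto
qed

lemma int_encode_diff: "int_encode (int a - int b) = 2 * (a - b) + (2 * (b - a) - 1)"
  by (cases "b \<le> a") (auto simp: int_encode_def sum_encode_def of_nat_diff nat_diff_distrib)

lemma set_encode_bounded: "set_encode {e. e < b \<and> P e} = (\<Sum>e<b. of_bool (P e) * 2 ^ e)"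
proof -
  have "(\<Sum>e<b. of_bool (P e) * 2 ^ e) = (\<Sum>e\<in>{e. e < b \<and> P e}. (2::nat) ^ e)"
    by (rule sum.mono_neutral_cong_right) auto
  then show ?thesis by (simp add: set_encode_def)
qed

lemma total_rec_set_encode:
  assumes P: "dec_rec (Suc n) (\<lambda>ys. P (ys ! 0) (tl ys))" and b: "total_rec n b"
  shows "total_rec n (\<lambda>xs. set_encode {e. e < b xs \<and> P e xs})"
  unfolding set_encode_bounded
  by (intro total_rec_sum total_rec_mult P[unfolded dec_rec_def] b total_rec_power total_rec_const
    total_rec_proj) auto

text \<open>Decoding is a search, which is bounded because both components of a pair are at most its code.\<close>

lemma total_rec_fst_prod_decode:
  assumes "total_rec n f" shows "total_rec n (\<lambda>xs. fst (prod_decode (f xs)))"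
proof -
  have *: "fst (prod_decode m) = (\<Sum>a<Suc m. of_bool (\<exists>b<Suc m. prod_encode (a, b) = m) * a)" for m
  proof -
    obtain a b where m: "m = prod_encode (a, b)"
      by (metis prod_decode_inverse surj_pair)
    have "of_bool (\<exists>b'<Suc m. prod_encode (a', b') = m) * a' = (if a' = a then a' else 0)" for a'
      using le_prod_encode_2[of b a] unfolding m by (auto simp: less_Suc_eq_le)
    then have "(\<Sum>a'<Suc m. of_bool (\<exists>b<Suc m. prod_encode (a', b) = m) * a')
        = (\<Sum>a'<Suc m. if a' = a then a' else 0)" by simp
    also have "\<dots> = a" using le_prod_encode_1[of a b] unfolding m by (subst sum.delta) auto
    finally show ?thesis by (simp add: m)
  qed
  show ?thesis unfolding *
    by (intro total_rec_sum total_rec_mult total_rec_Suc assms dec_rec_Ex[unfolded dec_rec_def]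
      dec_rec_eq[unfolded dec_rec_def] total_rec_prod_encode total_rec_tl total_rec_proj
      total_rec_nth_tl) auto
qed

lemma total_rec_snd_prod_decode:
  assumes "total_rec n f" shows "total_rec n (\<lambda>xs. snd (prod_decode (f xs)))"
proof -
  have *: "snd (prod_decode m) = (\<Sum>b<Suc m. of_bool (\<exists>a<Suc m. prod_encode (a, b) = m) * b)" for m
  proof -
    obtain a b where m: "m = prod_encode (a, b)"
      by (metis prod_decode_inverse surj_pair)
    have "of_bool (\<exists>a'<Suc m. prod_encode (a', b') = m) * b' = (if b' = b then b' else 0)" for b'
      using le_prod_encode_1[of a b] unfolding m by (auto simp: less_Suc_eq_le)
    then have "(\<Sum>b'<Suc m. of_bool (\<exists>a<Suc m. prod_encode (a, b') = m) * b')
        = (\<Sum>b'<Suc m. if b' = b then b' else 0)" by simp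
    also have "\<dots> = b" using le_prod_encode_2[of b a] unfolding m by (subst sum.delta) auto
    finally show ?thesis by (simp add: m)
  qed
  show ?thesis unfolding *
    by (intro total_rec_sum total_rec_mult total_rec_Suc assms dec_rec_Ex[unfolded dec_rec_def]
      dec_rec_eq[unfolded dec_rec_def] total_rec_prod_encode total_rec_tl total_rec_proj
      total_rec_nth_tl) auto
qed

text \<open>The quotient counts the positive multiples of \<open>c\<close> up to the dividend.\<close>

lemma total_rec_div_const:
  assumes "total_rec n f" "0 < c" shows "total_rec n (\<lambda>xs. f xs div c)"
proof -
  have *: "e div c = (\<Sum>q<e. of_bool (Suc q * c \<le> e))" for e
  proof -
    have "Suc q * c \<le> e \<longleftrightarrow> q < e div c" for q
      using assms(2) by (simp only: less_eq_div_iff_mult_less_eq[symmetric] Suc_le_eq[symmetric])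
    moreover have "{q. q < e \<and> q < e div c} = {..<e div c}"
      using div_le_dividend[of e c] by (auto intro: less_le_trans)
    ultimately show ?thesis by (simp add: sum.If_cases Int_def flip: of_bool_def)
  qed
  show ?thesis unfolding *
    by (intro total_rec_sum total_rec_mult total_rec_Suc assms total_rec_const
      dec_rec_le[unfolded dec_rec_def] total_rec_tl total_rec_proj) auto
qed

lemma total_rec_mod_const:
  assumes "total_rec n f" "0 < c" shows "total_rec n (\<lambda>xs. f xs mod c)"
  unfolding modulo_nat_def
  by (intro total_rec_diff total_rec_mult total_rec_div_const total_rec_const assms)

definition cell_index :: "cell \<Rightarrow> nat" where
  "cell_index = (\<lambda>(a, b). prod_encode (int_encode a, int_encode b))"

lemma cell_index_inj: "cell_index v = cell_index w \<longleftrightarrow> v = w"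
  by (auto simp: cell_index_def int_encode_eq split: prod.splits)

lemma cell_index_surj: "\<exists>v. cell_index v = e"
proof -
  obtain a b where "e = prod_encode (a, b)" by (metis prod_decode_inverse surj_pair)
  then have "cell_index (int_decode a, int_decode b) = e" by (simp add: cell_index_def)
  then show ?thesis ..
qed

text \<open>A generous bound: within this distance lie all cells that \<open>tile_rule\<close> below inspects, namely three consecutive
words and, in the bottom left corner, the flags of \<open>m + 1\<close> consecutive words.\<close>

definition radius :: "nat \<Rightarrow> nat \<Rightarrow> nat" where
  "radius k m = (m + 3) * k + 6"

text \<open>The neighbourhood is an initial segment of the enumeration of the cells rather than a box. Its code is then
\<open>2 ^ nbhd_size k m - 1\<close>, and the codes of its patterns are exactly the numbers below \<open>2 ^ nbhd_size k m\<close>.\<close>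

definition nbhd_size :: "nat \<Rightarrow> nat \<Rightarrow> nat" where
  "nbhd_size k m = Suc (prod_encode (2 * radius k m, 2 * radius k m))"

definition nbhd :: "nat \<Rightarrow> nat \<Rightarrow> cell set" where
  "nbhd k m = {v. cell_index v < nbhd_size k m}"

text \<open>The \<open>3 k \<times> 3\<close> cells around the word that starts \<open>j\<close> cells to the left of the origin, column by column, as a
number. Coordinates are written as differences of natural numbers, here and in \<open>tile_rule\<close>, because this is the
form in which \<open>int_encode\<close> is computed.\<close>

definition window :: "nat \<Rightarrow> nat \<Rightarrow> config \<Rightarrow> nat" where
  "window k j q = set_encode {e. e < 9 * k \<and> q (int (e div 3) - int (j + k), int (e mod 3) - int 1)}"

text \<open>A cell in state 0 stays 0 if it belongs to a word of length \<open>k\<close> whose window is allowed, that is, an element of the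
finite set \<open>s\<close>. Position 5 of a word will flag the bottom left corner of a frame and position 3 a unit of the
input; a corner is accepted only if the flags of the words that follow it spell the input \<open>m\<close> in unary. Thus the
input is a parameter of the rule and not of the set \<open>s\<close>.\<close>

definition tile_rule :: "nat \<Rightarrow> nat \<Rightarrow> nat \<Rightarrow> config \<Rightarrow> bool" where
  "tile_rule k s m q \<longleftrightarrow> q (0, 0) \<or>
     \<not> (\<exists>j<k. window k j q \<in> set_decode s \<and>
           (q (int 5 - int j, int 0 - int 0) \<longrightarrow>
             (\<forall>i<Suc m. q (int (i * k + 3) - int j, int 0 - int 0) \<longleftrightarrow> i < m)))"

lemma finite_nbhd: "finite (nbhd k m)"
proof -
  have "nbhd k m = cell_index -` {..<nbhd_size k m}" by (auto simp: nbhd_def)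
  then show ?thesis by (auto intro!: finite_vimageI injI simp: cell_index_inj)
qed

lemma in_nbhd:
  assumes "\<bar>a\<bar> \<le> int (radius k m)" "\<bar>b\<bar> \<le> int (radius k m)"
  shows "(a, b) \<in> nbhd k m"
proof -
  have *: "int_encode z \<le> 2 * r" if "\<bar>z\<bar> \<le> int r" for z r
    using that by (auto simp: int_encode_def sum_encode_def)
  have mono: "prod_encode (x, y) \<le> prod_encode (x', y')" if "x \<le> x'" "y \<le> y'" for x y x' y'
  proof -
    have "triangle u \<le> triangle v" if "u \<le> v" for u v
      using that by (induction rule: dec_induct) auto
    from this[of "x + y" "x' + y'"] that show ?thesis by (simp add: prod_encode_def)
  qed
  show ?thesis using mono[OF *[OF assms(1)] *[OF assms(2)]]
    by (simp add: nbhd_def nbhd_size_def cell_index_def)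
qed

lemma tile_rule_cong:
  assumes "\<And>v. v \<in> nbhd k m \<Longrightarrow> p v = q v"
  shows "tile_rule k s m p = tile_rule k s m q"
proof -
  have eq: "p (a, b) = q (a, b)" if "\<bar>a\<bar> \<le> int (radius k m)" "\<bar>b\<bar> \<le> int 1" for a b
  proof (intro assms in_nbhd that(1))
    have "1 \<le> radius k m" by (simp add: radius_def)
    then show "\<bar>b\<bar> \<le> int (radius k m)" using that(2) by linarith
  qed
  have 1: "window k j p = window k j q" if "j < k" for j
  proof -
    have "p (int (e div 3) - int (j + k), int (e mod 3) - int 1)
        = q (int (e div 3) - int (j + k), int (e mod 3) - int 1)" if "e < 9 * k" for e
    proof (rule eq)
      have "e div 3 < 3 * k" using that by (simp add: div_less_iff_less_mult)
      then have "e div 3 \<le> 3 * k" "j + k \<le> 2 * k" using \<open>j < k\<close> by auto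
      moreover have "3 * k \<le> radius k m" unfolding radius_def by (simp add: algebra_simps)
      ultimately show "\<bar>int (e div 3) - int (j + k)\<bar> \<le> int (radius k m)" by linarith
      show "\<bar>int (e mod 3) - int 1\<bar> \<le> int 1" by linarith
    qed
    then show ?thesis unfolding window_def by (intro arg_cong[where f = set_encode]) auto
  qed
  have 2: "p (int 5 - int j, int 0 - int 0) = q (int 5 - int j, int 0 - int 0)" if "j < k" for j
  proof (rule eq)
    have "k \<le> radius k m" "6 \<le> radius k m" unfolding radius_def by (simp_all add: algebra_simps)
    then show "\<bar>int 5 - int j\<bar> \<le> int (radius k m)" using that by linarith
  qed simp
  have 3: "p (int (i * k + 3) - int j, int 0 - int 0) = q (int (i * k + 3) - int j, int 0 - int 0)"
    if "j < k" "i < Suc m" for i j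
  proof (rule eq)
    have "i * k \<le> m * k" using that by simp
    moreover have "radius k m = m * k + 3 * k + 6" unfolding radius_def by (simp add: algebra_simps)
    ultimately have "i * k + 3 + k \<le> radius k m" by linarith
    then show "\<bar>int (i * k + 3) - int j\<bar> \<le> int (radius k m)" using that by linarith
  qed simp
  have 4: "p (0, 0) = q (0, 0)" by (rule eq) auto
  show ?thesis unfolding tile_rule_def 4 using 1 2 3 by (metis (no_types, lifting))
qed

lemma cells_code_eq: "cells_code D = set_encode (cell_index ` D)"
  by (simp add: cells_code_def cell_index_def)

lemma set_encode_less_iff:
  assumes "finite S" shows "set_encode S < 2 ^ A \<longleftrightarrow> S \<subseteq> {..<A}"
proof
  assume S: "set_encode S < 2 ^ A"
  have "(2::nat) ^ a \<le> set_encode S" if "a \<in> S" for a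
    unfolding set_encode_def using assms that by (intro member_le_sum) auto
  with S have "(2::nat) ^ a < 2 ^ A" if "a \<in> S" for a using that by (meson le_less_trans)
  then show "S \<subseteq> {..<A}" by auto
next
  assume "S \<subseteq> {..<A}"
  then have "set_encode S \<le> (\<Sum>i<A. 2 ^ i)" unfolding set_encode_def by (intro sum_mono2) auto
  also have "\<dots> < 2 ^ A" by (induction A) auto
  finally show "set_encode S < 2 ^ A" .
qed

text \<open>A pattern on the first \<open>A\<close> cells of the enumeration is an arbitrary number below \<open>2 ^ A\<close>.\<close>

lemma ca_code_initial_segment:
  fixes A :: nat
  defines "N \<equiv> {v. cell_index v < A}"
  shows "ca_code (N, F) = prod_encode (2 ^ A - 1,
    set_encode {c. c < 2 ^ A \<and> F (\<lambda>v\<in>N. cell_index v \<in> set_decode c)})"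
proof -
  have img: "cell_index ` {v \<in> N. p v} \<subseteq> {..<A}" for p by (auto simp: N_def)
  have "cell_index ` N = {..<A}"
  proof (intro equalityI subsetI)
    fix e assume "e \<in> {..<A}"
    then show "e \<in> cell_index ` N" using cell_index_surj[of e] by (auto simp: N_def)
  qed (auto simp: N_def)
  then have "cells_code N = 2 ^ A - 1" 
    by (simp add: cells_code_eq set_encode_def mask_eq_sum_exp_nat lessThan_def)
  moreover have "(\<lambda>p. cells_code {v \<in> N. p v}) ` {p \<in> N \<rightarrow>\<^sub>E UNIV. F p} =
     {c. c < 2 ^ A \<and> F (\<lambda>v\<in>N. cell_index v \<in> set_decode c)}" (is "?L = ?R")
  proof (intro equalityI subsetI)
    fix c assume "c \<in> ?L"
    then obtain p where p: "p \<in> N \<rightarrow>\<^sub>E UNIV" "F p" "c = set_encode (cell_index ` {v \<in> N. p v})"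
      by (auto simp: cells_code_eq)
    have fin: "finite (cell_index ` {v \<in> N. p v})" by (rule finite_subset[OF img]) simp
    have "(\<lambda>v\<in>N. cell_index v \<in> set_decode c) = p"
      using p(1) fin by (auto simp: p(3) PiE_def extensional_def restrict_def cell_index_inj)
    then show "c \<in> ?R" using p(2) set_encode_less_iff[OF fin] img p(3) by auto
  next
    fix c assume c: "c \<in> ?R"
    let ?p = "\<lambda>v\<in>N. cell_index v \<in> set_decode c"
    have "set_decode c \<subseteq> {..<A}" using set_encode_less_iff[of "set_decode c"] c by simp
    then have "cell_index v \<in> set_decode c \<Longrightarrow> v \<in> N" for v by (auto simp: N_def)
    then have "{v \<in> N. ?p v} = {v. cell_index v \<in> set_decode c}" by auto
    moreover have "cell_index ` \<dots> = set_decode c"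
    proof (intro equalityI subsetI)
      fix e assume "e \<in> set_decode c"
      then show "e \<in> cell_index ` {v. cell_index v \<in> set_decode c}" using cell_index_surj[of e] by auto
    qed auto
    ultimately have "cell_index ` {v \<in> N. ?p v} = set_decode c" by metis
    then have "cells_code {v \<in> N. ?p v} = c" by (simp add: cells_code_eq)
    then show "c \<in> ?L" using c by (intro image_eqI[of _ _ ?p]) auto
  qed
  ultimately show ?thesis by (simp add: ca_code_def)
qed

lemma dec_rec_tile_rule:
  assumes "total_rec n k" "total_rec n s" "total_rec n m" "total_rec n c"
  shows "dec_rec n (\<lambda>xs. tile_rule (k xs) (s xs) (m xs) (\<lambda>v. cell_index v \<in> set_decode (c xs)))"
proof -
  have ix: "cell_index (int a - int b, int c - int d)
     = prod_encode (2 * (a - b) + (2 * (b - a) - 1), 2 * (c - d) + (2 * (d - c) - 1))" for a b c d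
    by (simp add: cell_index_def int_encode_diff)
  have 0: "cell_index (0, 0) = 0" 
    by (simp add: cell_index_def int_encode_def sum_encode_def prod_encode_def)
  show ?thesis unfolding tile_rule_def window_def ix 0
    by (intro dec_rec_disj dec_rec_not dec_rec_Ex dec_rec_conj dec_rec_imp dec_rec_All dec_rec_iff
      dec_rec_bit dec_rec_less total_rec_set_encode total_rec_prod_encode total_rec_add total_rec_diff
      total_rec_mult total_rec_Suc total_rec_const total_rec_div_const total_rec_mod_const
      total_rec_proj total_rec_nth_tl total_rec_tl assms) auto
qed

lemma ca_code_tile_rule:
  "ca_code (nbhd k m, tile_rule k s m) = prod_encode (2 ^ nbhd_size k m - 1,
     set_encode {c. c < 2 ^ nbhd_size k m \<and> tile_rule k s m (\<lambda>v. cell_index v \<in> set_decode c)})"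
proof -
  have "tile_rule k s m (\<lambda>v\<in>nbhd k m. q v) = tile_rule k s m q" for q
    by (rule tile_rule_cong) simp
  then show ?thesis using ca_code_initial_segment[of "nbhd_size k m" "tile_rule k s m"]
    by (simp flip: nbhd_def)
qed

text \<open>The number \<open>m\<close> serves both as the description \<open>(k, s)\<close> of a rule and as the input that the rule imposes; this
is the self-reference of the diagonal argument.\<close>

theorem total_rec_ca_code:
  "total_rec 1 (\<lambda>xs. let m = xs ! 0; k = fst (prod_decode m); s = snd (prod_decode m) in
     ca_code (nbhd k m, tile_rule k s m))"
  unfolding Let_def ca_code_tile_rule nbhd_size_def radius_def
  by (intro total_rec_set_encode dec_rec_tile_rule total_rec_prod_encode total_rec_add total_rec_diff
      total_rec_mult total_rec_Suc total_rec_const total_rec_power total_rec_fst_prod_decode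
      total_rec_snd_prod_decode total_rec_proj total_rec_nth_tl total_rec_tl) auto

section \<open>Compiling recursive functions into counter machines\<close>

datatype 'q instr = Stop | Add nat 'q | Sub nat 'q | Test nat 'q 'q

fun cm_step :: "('q \<Rightarrow> 'q instr) \<Rightarrow> 'q \<times> (nat \<Rightarrow> nat) \<Rightarrow> ('q \<times> (nat \<Rightarrow> nat)) option" where
  "cm_step \<delta> (q, s) = (case \<delta> q of
      Stop \<Rightarrow> None
    | Add i q' \<Rightarrow> Some (q', s(i := Suc (s i)))
    | Sub i q' \<Rightarrow> Some (q', s(i := s i - 1))
    | Test i q\<^sub>0 q\<^sub>1 \<Rightarrow> Some (if s i = 0 then q\<^sub>0 else q\<^sub>1, s))"

definition cm_rel :: "('q \<Rightarrow> 'q instr) \<Rightarrow> (('q \<times> (nat \<Rightarrow> nat)) \<times> ('q \<times> (nat \<Rightarrow> nat))) set" where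
  "cm_rel \<delta> = {(c, c'). cm_step \<delta> c = Some c'}"

text \<open>Runs are deterministic, so that a halting run determines the final contents of the counters.\<close>

lemma cm_halt_unique:
  assumes "(c, (q, s)) \<in> (cm_rel \<delta>)\<^sup>*" "(c, (q', s')) \<in> (cm_rel \<delta>)\<^sup>*" "\<delta> q = Stop" "\<delta> q' = Stop"
  shows "s = s'"
  using assms(1,2)
proof (induction rule: converse_rtrancl_induct)
  case base
  then show ?case
    by (cases rule: converse_rtranclE) (auto simp: cm_rel_def assms(3))
next
  case (step c d)
  from step.prems show ?case
  proof (cases rule: converse_rtranclE)
    case base
    then show ?thesis using step.hyps(1) assms(4) by (auto simp: cm_rel_def)
  next
    case (step d')
    then have "d' = d" using \<open>(c, d) \<in> cm_rel \<delta>\<close> by (auto simp: cm_rel_def)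
    then show ?thesis using step \<open>(d, _) \<in> _ \<Longrightarrow> s = s'\<close> by simp
  qed
qed

text \<open>Structured programs over registers. The control state of the counter machine that runs a program is the list of
commands that remain to be executed; entering a loop body pushes the body in front of the loop.\<close>

datatype com = Inc nat | Dec nat | While nat "com list"

fun ctrl_step :: "com list \<Rightarrow> com list instr" where
  "ctrl_step [] = Stop"
| "ctrl_step (Inc i # K) = Add i K"
| "ctrl_step (Dec i # K) = Sub i K"
| "ctrl_step (While i p # K) = Test i K (p @ While i p # K)"

definition exec :: "com list \<Rightarrow> (nat \<Rightarrow> nat) \<Rightarrow> (nat \<Rightarrow> nat) \<Rightarrow> bool" where
  "exec p s t \<longleftrightarrow> (\<forall>K. ((p @ K, s), (K, t)) \<in> (cm_rel ctrl_step)\<^sup>*)"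

lemma exec_Nil: "exec [] s s"
  by (simp add: exec_def)

lemma exec_append: "exec p s t \<Longrightarrow> exec p' t u \<Longrightarrow> exec (p @ p') s u"
  unfolding exec_def by (metis append.assoc rtrancl_trans)

lemma exec_Cons: "exec [c] s t \<Longrightarrow> exec p t u \<Longrightarrow> exec (c # p) s u"
  using exec_append[of "[c]"] by simp

lemma exec_Inc: "exec [Inc i] s (s(i := Suc (s i)))"
  unfolding exec_def by (auto simp: cm_rel_def intro!: r_into_rtrancl)

lemma exec_Dec: "exec [Dec i] s (s(i := s i - 1))"
  unfolding exec_def by (auto simp: cm_rel_def intro!: r_into_rtrancl)

lemma exec_While_0: "s i = 0 \<Longrightarrow> exec [While i p] s s"
  unfolding exec_def by (auto simp: cm_rel_def intro!: r_into_rtrancl)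

lemma exec_While_Suc:
  assumes "s i \<noteq> 0" "exec p s t" "exec [While i p] t u"
  shows "exec [While i p] s u"
  unfolding exec_def
proof
  fix K
  have "((While i p # K, s), (p @ While i p # K, s)) \<in> cm_rel ctrl_step"
    using assms(1) by (simp add: cm_rel_def)
  also have "((p @ While i p # K, s), (While i p # K, t)) \<in> (cm_rel ctrl_step)\<^sup>*"
    using assms(2) by (simp add: exec_def)
  also have "((While i p # K, t), (K, u)) \<in> (cm_rel ctrl_step)\<^sup>*"
    using assms(3) by (simp add: exec_def)
  finally show "(([While i p] @ K, s), (K, u)) \<in> (cm_rel ctrl_step)\<^sup>*" by simp
qed

definition clear :: "nat \<Rightarrow> com list" where
  "clear i = [While i [Dec i]]"

lemma exec_clear: "exec (clear i) s (s(i := 0))"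
proof (induction "s i" arbitrary: s)
  case 0
  then have "s(i := 0) = s" by auto
  then show ?case using exec_While_0[of s i] 0 by (simp add: clear_def)
next
  case (Suc n)
  have "exec (clear i) (s(i := s i - 1)) (s(i := 0))"
    using Suc(1)[of "s(i := s i - 1)"] Suc(2) by simp
  then show ?case using exec_While_Suc[OF _ exec_Dec] Suc(2) by (metis clear_def nat.distinct(1))
qed

text \<open>Reading a register empties it, so that a second copy in \<open>tmp\<close> is needed to restore it.\<close>

definition copy :: "nat \<Rightarrow> nat \<Rightarrow> nat \<Rightarrow> com list" where
  "copy a out tmp = clear out @ clear tmp @
     [While a [Dec a, Inc out, Inc tmp], While tmp [Dec tmp, Inc a]]"

lemma exec_copy:
  assumes "a \<noteq> out" "a \<noteq> tmp" "out \<noteq> tmp"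
  shows "exec (copy a out tmp) s (s(out := s a, tmp := 0))"
proof -
  have 1: "exec [While a [Dec a, Inc out, Inc tmp]] s (s(a := 0, out := s out + s a, tmp := s tmp + s a))"
    for s
  proof (induction "s a" arbitrary: s)
    case 0
    then have eq: "s(a := 0, out := s out + s a, tmp := s tmp + s a) = s" by auto
    show ?case unfolding eq using exec_While_0[of s a] 0 by simp
  next
    case (Suc n)
    let ?t = "s(a := s a - 1, out := Suc (s out), tmp := Suc (s tmp))"
    have "exec [Dec a, Inc out, Inc tmp] s ?t"
      using exec_Cons[OF exec_Dec exec_Cons[OF exec_Inc exec_Inc], of a out tmp s] assms by simp
    moreover have "?t(a := 0, out := ?t out + ?t a, tmp := ?t tmp + ?t a)
        = s(a := 0, out := s out + s a, tmp := s tmp + s a)"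
      using Suc(2) assms by (auto simp: fun_eq_iff)
    then have "exec [While a [Dec a, Inc out, Inc tmp]] ?t (s(a := 0, out := s out + s a, tmp := s tmp + s a))"
      using Suc(1)[of ?t] Suc(2) assms by simp
    ultimately show ?case using exec_While_Suc Suc(2) by (metis nat.distinct(1))
  qed
  have 2: "exec [While tmp [Dec tmp, Inc a]] s (s(a := s a + s tmp, tmp := 0))" for s
  proof (induction "s tmp" arbitrary: s)
    case 0
    then have "s(a := s a + s tmp, tmp := 0) = s" by auto
    then show ?case using exec_While_0[of s tmp] 0 by simp
  next
    case (Suc n)
    let ?t = "s(tmp := s tmp - 1, a := Suc (s a))"
    have "exec [Dec tmp, Inc a] s ?t"
      using exec_Cons[OF exec_Dec exec_Inc, of tmp a s] assms by simp
    moreover have "?t(a := ?t a + ?t tmp, tmp := 0) = s(a := s a + s tmp, tmp := 0)"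
      using Suc(2) assms by (auto simp: fun_eq_iff)
    then have "exec [While tmp [Dec tmp, Inc a]] ?t (s(a := s a + s tmp, tmp := 0))"
      using Suc(1)[of ?t] Suc(2) assms by simp
    ultimately show ?case using exec_While_Suc Suc(2) by (metis nat.distinct(1))
  qed
  let ?s1 = "s(out := 0, tmp := 0)"
  let ?s2 = "?s1(a := 0, out := ?s1 out + ?s1 a, tmp := ?s1 tmp + ?s1 a)"
  have "exec (copy a out tmp) s (?s2(a := ?s2 a + ?s2 tmp, tmp := 0))"
    unfolding copy_def
    by (intro exec_append[OF exec_clear] exec_append[OF exec_clear] exec_Cons[OF 1] 2)
  moreover have "?s2(a := ?s2 a + ?s2 tmp, tmp := 0) = s(out := s a, tmp := 0)"
    using assms by (auto simp: fun_eq_iff)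
  ultimately show ?thesis by simp
qed

text \<open>\<open>compile f as out b\<close> takes its arguments from the registers \<open>as\<close> and leaves its result in \<open>out\<close>; the
registers from \<open>b\<close> on are scratch space. A local variable of the code is placed at \<open>b\<close>, and the code of the
subterms gets a correspondingly higher scratch area.\<close>

primrec compile :: "recf \<Rightarrow> nat list \<Rightarrow> nat \<Rightarrow> nat \<Rightarrow> com list" where
  "compile Zero = (\<lambda>as out b. clear out)"
| "compile Succ = (\<lambda>as out b. copy (hd as) out b @ [Inc out])"
| "compile (Proj i) = (\<lambda>as out b. copy (as ! i) out b)"
| "compile (Comp f gs) = (\<lambda>as out b. let n = length gs in
     concat (map2 (\<lambda>g j. g as (b + j) (b + n)) (map compile gs) [0..<n]) @
     compile f [b..<b + n] out (b + n))"
| "compile (PrimRec f g) = (\<lambda>as out b.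
     copy (hd as) b (b + 4) @ clear (b + 1) @ compile f (tl as) (b + 2) (b + 4) @
     [While b (Dec b # compile g ((b + 1) # (b + 2) # tl as) (b + 3) (b + 4) @
        copy (b + 3) (b + 2) (b + 4) @ [Inc (b + 1)])] @
     copy (b + 2) out (b + 4))"
| "compile (Mu f) = (\<lambda>as out b.
     clear b @ compile f (b # as) (b + 1) (b + 2) @
     [While (b + 1) (Inc b # compile f (b # as) (b + 1) (b + 2))] @ copy b out (b + 2))"

text \<open>Preserving the registers below \<open>b\<close> is what allows an enclosing program to reuse its arguments. Nothing is
said about the scratch registers, before or after: every piece of code clears those it uses.\<close>

definition computes :: "com list \<Rightarrow> nat \<Rightarrow> nat \<Rightarrow> (nat \<Rightarrow> nat) \<Rightarrow> nat \<Rightarrow> bool" where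
  "computes p out b s z \<longleftrightarrow> (\<exists>t. exec p s t \<and> t out = z \<and> (\<forall>i<b. i \<noteq> out \<longrightarrow> t i = s i))"

lemma eval_PrimRec_chain:
  assumes "eval (PrimRec f g) (n # xs) z"
  shows "\<exists>Y. Y n = z \<and> eval f xs (Y 0) \<and> (\<forall>j<n. eval g (j # Y j # xs) (Y (Suc j)))"
  using assms
proof (induction n arbitrary: z)
  case 0
  then show ?case by (cases rule: eval.cases) auto
next
  case (Suc n)
  from Suc.prems obtain y where y: "eval (PrimRec f g) (n # xs) y" "eval g (n # y # xs) z"
    by (cases rule: eval.cases) auto
  from Suc.IH[OF y(1)] obtain Y where
    "Y n = y" "eval f xs (Y 0)" "\<forall>j<n. eval g (j # Y j # xs) (Y (Suc j))" by blast
  then show ?case using y(2) by (intro exI[of _ "Y(Suc n := z)"]) (auto simp: less_Suc_eq)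
qed

text \<open>Only terminating evaluations matter here, since the function that will be compiled is total on its inputs. The
loop invariants say that after \<open>j\<close> rounds the accumulator holds the value of the recursion at \<open>j\<close>, respectively
that the search has reached \<open>j\<close> and the test value for \<open>j\<close> is in its register.\<close>

lemma compile_correct:
  assumes "eval f xs z" "map s as = xs" "\<forall>a\<in>set as. a < b" "out < b" "out \<notin> set as"
  shows "computes (compile f as out b) out b s z"
  using assms
proof (induction f arbitrary: xs z s as out b)
  case Zero
  then have "z = 0" by (auto elim: eval.cases)
  then show ?case using exec_clear[of out s] unfolding computes_def by (intro exI[of _ "s(out := 0)"]) auto
next
  case Succ
  then obtain x where x: "xs = [x]" "z = Suc x" by (auto elim: eval.cases)
  then obtain a where a: "as = [a]" "s a = x" using Succ by (auto simp: map_eq_Cons_conv)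
  have "exec (copy a out b @ [Inc out]) s ((s(out := s a, b := 0))(out := Suc ((s(out := s a, b := 0)) out)))"
    using Succ a by (intro exec_append[OF exec_copy exec_Inc]) auto
  then show ?case unfolding computes_def using a x Succ by fastforce
next
  case (Proj i)
  then have "i < length xs" "z = xs ! i" by (auto elim: eval.cases)
  then have i: "i < length as" "z = s (as ! i)" using Proj(2) by auto
  then have "as ! i \<in> set as" by simp
  then have "exec (copy (as ! i) out b) s (s(out := s (as ! i), b := 0))"
    using Proj by (intro exec_copy) auto
  then show ?case unfolding computes_def using i Proj by fastforce
next
  case (Comp f gs)
  let ?n = "length gs"
  from Comp.prems(1) obtain ys where ys: "list_all2 (\<lambda>g y. eval g xs y) gs ys" "eval f ys z"
    by (auto elim: eval.cases)
  then have len: "length ys = ?n" by (simp add: list_all2_lengthD)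
  define ps where "ps = map2 (\<lambda>g j. g as (b + j) (b + ?n)) (map compile gs) [0..<?n]"
  have lps: "length ps = ?n" by (simp add: ps_def)
  have "\<exists>t. exec (concat (take j ps)) s t \<and> (\<forall>i<j. t (b + i) = ys ! i) \<and> (\<forall>i<b. t i = s i)"
    if "j \<le> ?n" for j
    using that
  proof (induction j)
    case 0
    then show ?case using exec_Nil by auto
  next
    case (Suc j)
    then obtain t where t: "exec (concat (take j ps)) s t" "\<forall>i<j. t (b + i) = ys ! i" "\<forall>i<b. t i = s i"
      by auto
    have p: "ps ! j = compile (gs ! j) as (b + j) (b + ?n)" using Suc by (simp add: ps_def)
    have "map t as = xs" using Comp.prems(2,3) t(3) by auto
    then have "computes (ps ! j) (b + j) (b + ?n) t (ys ! j)"
      unfolding p using Suc.prems Comp.prems ys(1)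
      by (intro Comp.IH(2)[of "gs ! j" xs]) (auto simp: list_all2_conv_all_nth)
    then obtain u where u: "exec (ps ! j) t u" "u (b + j) = ys ! j"
      "\<forall>i<b + ?n. i \<noteq> b + j \<longrightarrow> u i = t i" by (auto simp: computes_def)
    have "exec (concat (take (Suc j) ps)) s u"
      using exec_append[OF t(1) u(1)] Suc.prems by (simp add: take_Suc_conv_app_nth lps)
    then show ?case using u t Suc.prems by (intro exI[of _ u]) (auto simp: less_Suc_eq)
  qed
  from this[of ?n] lps obtain t where t: "exec (concat ps) s t" "\<forall>i<?n. t (b + i) = ys ! i"
    "\<forall>i<b. t i = s i" by auto
  have "map t [b..<b + ?n] = ys" using t(2) len by (auto intro!: nth_equalityI)
  then have "computes (compile f [b..<b + ?n] out (b + ?n)) out (b + ?n) t z"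
    using Comp.prems by (intro Comp.IH(1)[OF ys(2)]) auto
  then obtain u where u: "exec (compile f [b..<b + ?n] out (b + ?n)) t u" "u out = z"
    "\<forall>i<b + ?n. i \<noteq> out \<longrightarrow> u i = t i" by (auto simp: computes_def)
  have "exec (compile (Comp f gs) as out b) s u"
    using exec_append[OF t(1) u(1)] by (simp add: Let_def ps_def)
  then show ?case unfolding computes_def using u t by (intro exI[of _ u]) auto
next
  case (PrimRec f g)
  from PrimRec.prems(1) obtain n ys where xs: "xs = n # ys" by (auto elim: eval.cases)
  obtain Y where Y: "Y n = z" "eval f ys (Y 0)" "\<And>j. j < n \<Longrightarrow> eval g (j # Y j # ys) (Y (Suc j))"
    using eval_PrimRec_chain PrimRec.prems(1) xs by blast
  obtain a as' where as: "as = a # as'" "s a = n" "map s as' = ys"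
    using PrimRec.prems(2) xs by (auto simp: map_eq_Cons_conv)
  have bnd: "a < b" "\<forall>x\<in>set as'. x < b" "out < b" "out \<noteq> a" "out \<notin> set as'"
    using PrimRec.prems as by auto
  let ?s1 = "s(b := n, b + 4 := 0, b + 1 := 0)"
  have 1: "exec (copy a b (b + 4) @ clear (b + 1)) s ?s1"
  proof -
    have "exec (copy a b (b + 4) @ clear (b + 1)) s ((s(b := s a, b + 4 := 0))(b + 1 := 0))"
      using bnd by (intro exec_append[OF exec_copy exec_clear]) auto
    then show ?thesis by (simp add: as(2))
  qed
  have "?s1 x = s x" if "x \<in> set as'" for x
  proof -
    have "x < b" using bnd(2) that by blast
    then show ?thesis by auto
  qed
  then have "map ?s1 as' = ys" unfolding as(3)[symmetric] by (intro map_cong refl)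
  then have "computes (compile f as' (b + 2) (b + 4)) (b + 2) (b + 4) ?s1 (Y 0)"
    using bnd by (intro PrimRec.IH(1)[OF Y(2)]) auto
  then obtain s2 where s2: "exec (compile f as' (b + 2) (b + 4)) ?s1 s2" "s2 (b + 2) = Y 0"
    "\<forall>i<b + 4. i \<noteq> b + 2 \<longrightarrow> s2 i = ?s1 i" by (auto simp: computes_def)
  let ?p = "Dec b # compile g ((b + 1) # (b + 2) # as') (b + 3) (b + 4) @
        copy (b + 3) (b + 2) (b + 4) @ [Inc (b + 1)]"
  have loop: "\<exists>t. exec [While b ?p] u t \<and> t (b + 2) = z \<and> (\<forall>i<b. t i = s i)"
    if "u b = n - j" "j \<le> n" "u (b + 1) = j" "u (b + 2) = Y j" "\<forall>i<b. u i = s i" for u j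
    using that
  proof (induction "n - j" arbitrary: j u)
    case 0
    then have "u b = 0" "j = n" by auto
    then show ?case using 0 Y(1) exec_While_0[of u b ?p] by (intro exI[of _ u]) auto
  next
    case (Suc d)
    then have j: "j < n" by auto
    let ?u1 = "u(b := u b - 1)"
    have "map ?u1 as' = ys" using as(3) bnd(2) Suc.prems(5) by (auto simp: map_eq_conv)
    then have "computes (compile g ((b + 1) # (b + 2) # as') (b + 3) (b + 4)) (b + 3) (b + 4) ?u1 (Y (Suc j))"
      using bnd Suc.prems by (intro PrimRec.IH(2)[OF Y(3)[OF j]]) auto
    then obtain u2 where u2: "exec (compile g ((b + 1) # (b + 2) # as') (b + 3) (b + 4)) ?u1 u2"
      "u2 (b + 3) = Y (Suc j)" "\<forall>i<b + 4. i \<noteq> b + 3 \<longrightarrow> u2 i = ?u1 i" by (auto simp: computes_def)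
    let ?u3 = "u2(b + 2 := u2 (b + 3), b + 4 := 0)"
    let ?u4 = "?u3(b + 1 := Suc (?u3 (b + 1)))"
    have "exec ?p u ?u4"
      by (intro exec_Cons[OF exec_Dec] exec_append[OF u2(1)] exec_append[OF exec_copy] exec_Inc) auto
    moreover have "u b \<noteq> 0" using Suc by auto
    moreover obtain t where t: "exec [While b ?p] ?u4 t" "t (b + 2) = z" "\<forall>i<b. t i = s i"
    proof -
      have "\<exists>t. exec [While b ?p] ?u4 t \<and> t (b + 2) = z \<and> (\<forall>i<b. t i = s i)"
        using Suc.prems j u2 by (intro Suc.hyps(1)[of "Suc j"]) (use Suc.hyps(2) in auto)
      then show ?thesis using that by blast
    qed
    ultimately have "exec [While b ?p] u t" by (intro exec_While_Suc[of u b ?p ?u4])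
    then show ?case using t by blast
  qed
  have "\<exists>t. exec [While b ?p] s2 t \<and> t (b + 2) = z \<and> (\<forall>i<b. t i = s i)"
    using s2 by (intro loop[of s2 0]) auto
  then obtain s3 where s3: "exec [While b ?p] s2 s3" "s3 (b + 2) = z" "\<forall>i<b. s3 i = s i" by blast
  have "exec (copy (b + 2) out (b + 4)) s3 (s3(out := s3 (b + 2), b + 4 := 0))"
    using bnd by (intro exec_copy) auto
  from exec_append[OF exec_append[OF 1 s2(1)] exec_append[OF s3(1) this]]
  have "exec (compile (PrimRec f g) as out b) s (s3(out := s3 (b + 2), b + 4 := 0))"
    by (simp add: as(1))
  then show ?case unfolding computes_def using s3 bnd(3) by fastforce
next
  case (Mu f)
  from Mu.prems(1) have z: "eval f (z # xs) 0" "\<And>m. m < z \<Longrightarrow> \<exists>y>0. eval f (m # xs) y"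
    by (auto elim: eval.cases)
  have step: "\<exists>t. exec (compile f (b # as) (b + 1) (b + 2)) u t \<and> t (b + 1) = y \<and> t b = j \<and> (\<forall>i<b. t i = s i)"
    if "u b = j" "\<forall>i<b. u i = s i" "eval f (j # xs) y" for u j y
  proof -
    have "map u as = xs" using Mu.prems(2,3) that(2) by auto
    then have "computes (compile f (b # as) (b + 1) (b + 2)) (b + 1) (b + 2) u y"
      using Mu.prems that by (intro Mu.IH[OF that(3)]) auto
    then show ?thesis using that(1,2) by (auto simp: computes_def)
  qed
  let ?p = "Inc b # compile f (b # as) (b + 1) (b + 2)"
  have loop: "\<exists>t. exec [While (b + 1) ?p] u t \<and> t b = z \<and> (\<forall>i<b. t i = s i)"
    if "j \<le> z" "u b = j" "u (b + 1) = y" "eval f (j # xs) y" "j < z \<longrightarrow> 0 < y" "j = z \<longrightarrow> y = 0"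
      "\<forall>i<b. u i = s i" for u j y
    using that
  proof (induction "z - j" arbitrary: j u y)
    case 0
    then have "j = z" "u (b + 1) = 0" by auto
    then show ?case using 0 exec_While_0[of u "b + 1" ?p] by (intro exI[of _ u]) auto
  next
    case (Suc d)
    then have j: "j < z" by auto
    obtain y' where y': "eval f (Suc j # xs) y'" "Suc j < z \<longrightarrow> 0 < y'" "Suc j = z \<longrightarrow> y' = 0"
      using z j by (metis Suc_lessI less_irrefl)
    obtain t where t: "exec (compile f (b # as) (b + 1) (b + 2)) (u(b := Suc (u b))) t"
      "t (b + 1) = y'" "t b = Suc j" "\<forall>i<b. t i = s i"
      using step[of "u(b := Suc (u b))" "Suc j" y'] Suc.prems y' by auto
    have "exec ?p u t" by (rule exec_Cons[OF exec_Inc t(1)])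
    moreover have "u (b + 1) \<noteq> 0" using Suc.prems j by auto
    moreover obtain v where v: "exec [While (b + 1) ?p] t v" "v b = z" "\<forall>i<b. v i = s i"
    proof -
      have "\<exists>v. exec [While (b + 1) ?p] t v \<and> v b = z \<and> (\<forall>i<b. v i = s i)"
        using t y' j Suc.hyps(2) by (intro Suc.hyps(1)[of "Suc j" t y']) auto
      then show ?thesis using that by blast
    qed
    ultimately have "exec [While (b + 1) ?p] u v" by (intro exec_While_Suc[of u "b + 1" ?p t])
    then show ?case using v by blast
  qed
  obtain y where y: "eval f (0 # xs) y" "0 < z \<longrightarrow> 0 < y" "0 = z \<longrightarrow> y = 0" using z by (metis gr0I)
  obtain t where t: "exec (compile f (b # as) (b + 1) (b + 2)) (s(b := 0)) t"
    "t (b + 1) = y" "t b = 0" "\<forall>i<b. t i = s i"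
    using step[of "s(b := 0)" 0 y] y by auto
  obtain u where u: "exec [While (b + 1) ?p] t u" "u b = z" "\<forall>i<b. u i = s i"
    using loop[of 0 t y] t y by auto
  have "exec (copy b out (b + 2)) u (u(out := u b, b + 2 := 0))"
    using Mu.prems by (intro exec_copy) auto
  from exec_append[OF exec_append[OF exec_clear t(1)] exec_append[OF u(1) this]]
  have "exec (compile (Mu f) as out b) s (u(out := u b, b + 2 := 0))" by simp
  then show ?case unfolding computes_def using u Mu.prems(4) by fastforce
qed

text \<open>The stacks that can occur while \<open>p\<close> runs on top of \<open>K\<close>. There are finitely many, although the stack is not
bounded syntactically: each is a tail of the program text, completed by the loops that enclose it.\<close>

function (sequential) conts :: "com list \<Rightarrow> com list \<Rightarrow> com list set" where
  "conts [] K = {K}"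
| "conts (While i p # p') K = insert (While i p # p' @ K) (conts p (While i p # p' @ K) \<union> conts p' K)"
| "conts (c # p') K = insert (c # p' @ K) (conts p' K)"
  by pat_completeness auto
termination by (relation "Wellfounded.measure (\<lambda>(p, K). size_list size p)") auto

lemma finite_conts: "finite (conts p K)"
  by (induction p K rule: conts.induct) auto

lemma conts_start: "p @ K \<in> conts p K"
  by (induction p K rule: conts.induct) auto

fun targets :: "'q instr \<Rightarrow> 'q set" where
  "targets Stop = {}" | "targets (Add i q) = {q}" | "targets (Sub i q) = {q}" | "targets (Test i q q') = {q, q'}"

fun instr_regs :: "'q instr \<Rightarrow> nat set" where
  "instr_regs Stop = {}" | "instr_regs (Add i q) = {i}" | "instr_regs (Sub i q) = {i}"
| "instr_regs (Test i q q') = {i}"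

lemma conts_closed:
  assumes "q \<in> conts p K" "q \<noteq> K" shows "targets (ctrl_step q) \<subseteq> conts p K"
  using assms
proof (induction p K rule: conts.induct)
  case (2 i p p' K)
  have "conts p (While i p # p' @ K) \<subseteq> conts (While i p # p') K" "conts p' K \<subseteq> conts (While i p # p') K"
    by auto
  then show ?case
    using 2 conts_start[of p "While i p # p' @ K"] conts_start[of p' K] by (fastforce simp: )
qed (auto simp: conts_start)

section \<open>Counter machines as tilings of rectangles\<close>

text \<open>The four edge predicates mark the frame of a rectangle: \<open>H\<close> and \<open>V\<close> never cross an edge and
propagate the edge markings along rows and columns.\<close>

locale tile_system =
  fixes A :: "'a set" and H V :: "'a \<Rightarrow> 'a \<Rightarrow> bool" and lft rgt upr lwr inp :: "'a \<Rightarrow> bool"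
  assumes finite_A: "finite A"
    and H_sides: "H a c \<Longrightarrow> \<not> rgt a \<and> \<not> lft c \<and> (upr a \<longleftrightarrow> upr c) \<and> (lwr a \<longleftrightarrow> lwr c)"
    and V_sides: "V a c \<Longrightarrow> \<not> upr a \<and> \<not> lwr c \<and> (lft a \<longleftrightarrow> lft c) \<and> (rgt a \<longleftrightarrow> rgt c)"
    and rgt_no_inp: "a \<in> A \<Longrightarrow> rgt a \<Longrightarrow> \<not> inp a"
begin

definition tiling :: "nat \<Rightarrow> nat \<Rightarrow> nat \<Rightarrow> (nat \<Rightarrow> nat \<Rightarrow> 'a) \<Rightarrow> bool" where
  "tiling m w h L \<longleftrightarrow> m < w \<and> 0 < h \<and> (\<forall>i\<le>m. inp (L i 0) \<longleftrightarrow> i < m) \<and>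
     (\<forall>x<w. \<forall>y<h. L x y \<in> A \<and> (lft (L x y) \<longleftrightarrow> x = 0) \<and> (rgt (L x y) \<longleftrightarrow> Suc x = w) \<and>
        (lwr (L x y) \<longleftrightarrow> y = 0) \<and> (upr (L x y) \<longleftrightarrow> Suc y = h) \<and>
        (Suc x < w \<longrightarrow> H (L x y) (L (Suc x) y)) \<and> (Suc y < h \<longrightarrow> V (L x y) (L x (Suc y))))"

end

text \<open>Column \<open>x\<close> of a row that represents the configuration \<open>(q, s)\<close> knows \<open>q\<close> and the sets of counters \<open>i\<close>
with \<open>x \<le> s i\<close> (\<open>prev\<close>), with \<open>x < s i\<close> (\<open>here\<close>) and with \<open>x + 1 < s i\<close> (\<open>nxt\<close>). The outer two
repeat what the horizontal neighbours know. They make the update of a counter, which shifts the end of its unary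
representation by one column, visible to the tile directly above, so that no diagonal constraints are needed.\<close>

datatype 'q tile = Tile (lft: bool) (rgt: bool) (upr: bool) (lwr: bool)
  (ctrl: 'q) (prev: "nat set") (here: "nat set") (nxt: "nat set")

locale counter_machine =
  fixes \<delta> :: "'q \<Rightarrow> 'q instr" and Q :: "'q set" and q\<^sub>0 :: 'q and B :: nat
  assumes finite_Q: "finite Q" and start_Q: "q\<^sub>0 \<in> Q" and B_gt: "1 < B"
    and closed: "q \<in> Q \<Longrightarrow> targets (\<delta> q) \<subseteq> Q"
    and regs: "q \<in> Q \<Longrightarrow> instr_regs (\<delta> q) \<subseteq> {..<B}"
begin

text \<open>On the right edge all counters have ended, which forces the rectangle to be wide enough for the run. In
the bottom row the counters other than the input counter 1 start at 0; the value of counter 1 is fixed by the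
condition on \<open>inp\<close> in \<open>tiling\<close>. On top, the machine has stopped with a positive counter 0.\<close>

definition tiles :: "'q tile set" where
  "tiles = {c. ctrl c \<in> Q \<and> prev c \<subseteq> {..<B} \<and> here c \<subseteq> prev c \<and> nxt c \<subseteq> {..<B} \<and>
     (lft c \<longrightarrow> prev c = {..<B}) \<and> (rgt c \<longrightarrow> here c = {} \<and> nxt c = {}) \<and>
     (lwr c \<longrightarrow> ctrl c = q\<^sub>0 \<and> here c \<subseteq> {1}) \<and>
     (upr c \<longrightarrow> \<delta> (ctrl c) = Stop \<and> (lft c \<longrightarrow> 0 \<in> here c))}"

definition H :: "'q tile \<Rightarrow> 'q tile \<Rightarrow> bool" where
  "H a c \<longleftrightarrow> \<not> rgt a \<and> \<not> lft c \<and> (upr a \<longleftrightarrow> upr c) \<and> (lwr a \<longleftrightarrow> lwr c) \<and>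
     ctrl a = ctrl c \<and> here a = prev c \<and> nxt a = here c"

text \<open>A zero test can be decided only in the leftmost column, which sees whether the counter is 0; \<open>H\<close> then spreads
the new control state over the row.\<close>

definition V :: "'q tile \<Rightarrow> 'q tile \<Rightarrow> bool" where
  "V a c \<longleftrightarrow> \<not> upr a \<and> \<not> lwr c \<and> (lft a \<longleftrightarrow> lft c) \<and> (rgt a \<longleftrightarrow> rgt c) \<and>
     (case \<delta> (ctrl a) of
        Stop \<Rightarrow> False
      | Add i q \<Rightarrow> ctrl c = q \<and> here c = here a - {i} \<union> {i} \<inter> prev a
      | Sub i q \<Rightarrow> ctrl c = q \<and> here c = here a - {i} \<union> {i} \<inter> nxt a
      | Test i q q' \<Rightarrow> here c = here a \<and> (lft a \<longrightarrow> ctrl c = (if i \<in> here a then q' else q)))"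

lemma finite_tiles: "finite tiles"
proof -
  let ?P = "Pow {..<B}"
  let ?S = "(UNIV :: bool set) \<times> (UNIV :: bool set) \<times> (UNIV :: bool set) \<times> (UNIV :: bool set) \<times>
    Q \<times> ?P \<times> ?P \<times> ?P"
  have "tiles \<subseteq> (\<lambda>(l, r, t, b, q, x, y, z). Tile l r t b q x y z) ` ?S"
  proof
    fix c assume "c \<in> tiles"
    then show "c \<in> (\<lambda>(l, r, t, b, q, x, y, z). Tile l r t b q x y z) ` ?S"
      by (intro image_eqI[of _ _ "(lft c, rgt c, upr c, lwr c, ctrl c, prev c, here c, nxt c)"])
        (auto simp: tiles_def)
  qed
  then show ?thesis by (rule finite_subset) (intro finite_imageI finite_cartesian_product; simp add: finite_Q)
qed

sublocale tile_system tiles H V lft rgt upr lwr "\<lambda>c. Suc 0 \<in> here c"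
  by unfold_locales (rule finite_tiles, auto simp: H_def V_def tiles_def)

text \<open>The space-time diagram of the run, in a frame wider than all counter values that occur.\<close>

lemma tiling_if_halts:
  assumes "((q\<^sub>0, (\<lambda>_. 0)(1 := m)), (q, t)) \<in> (cm_rel \<delta>)\<^sup>*" "\<delta> q = Stop" "0 < t 0"
  shows "\<exists>w h L. tiling m w h L"
proof -
  from assms(1) obtain n where "((q\<^sub>0, (\<lambda>_. 0)(1 := m)), (q, t)) \<in> cm_rel \<delta> ^^ n"
    by (auto dest: rtrancl_imp_relpow)
  then obtain cf where cf: "cf 0 = (q\<^sub>0, (\<lambda>_. 0)(1 := m))" "cf n = (q, t)"
    "\<And>y. y < n \<Longrightarrow> (cf y, cf (Suc y)) \<in> cm_rel \<delta>"
    unfolding relpow_fun_conv by blast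
  define qs where "qs y = fst (cf y)" for y
  define s where "s y = snd (cf y)" for y
  have step: "cm_step \<delta> (qs y, s y) = Some (qs (Suc y), s (Suc y))" if "y < n" for y
    using cf(3)[OF that] by (simp add: cm_rel_def qs_def s_def)
  have Q: "qs y \<in> Q" if "y \<le> n" for y
    using that
  proof (induction y)
    case 0
    then show ?case by (simp add: qs_def cf start_Q)
  next
    case (Suc y)
    then show ?case using step[of y] closed[of "qs y"]
      by (cases "\<delta> (qs y)") (auto split: if_splits)
  qed
  define w where "w = Suc (Suc (Max ((\<lambda>(y, i). s y i) ` ({..n} \<times> {..<B}))))"
  have w: "Suc (s y i) < w" if "y \<le> n" "i < B" for y i
    unfolding w_def using that by (auto intro!: le_imp_less_Suc Max_ge)
  define L where "L x y = Tile (x = 0) (Suc x = w) (y = n) (y = 0) (qs y)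
     {i. i < B \<and> x \<le> s y i} {i. i < B \<and> x < s y i} {i. i < B \<and> Suc x < s y i}" for x y
  have s0: "s 0 = (\<lambda>_. 0)(1 := m)" "qs 0 = q\<^sub>0" by (simp_all add: s_def qs_def cf)
  have sn: "s n = t" "qs n = q" by (simp_all add: s_def qs_def cf)
  have A: "L x y \<in> tiles" if "x < w" "y < Suc n" for x y
  proof -
    have "\<not> x < s y i" "\<not> Suc x < s y i" if "Suc x = w" "i < B" for i
      using w[of y i] that \<open>y < Suc n\<close> by auto
    then show ?thesis
      using that Q[of y] s0 sn assms(2,3) B_gt by (auto simp: tiles_def L_def split: if_splits)
  qed
  have V: "V (L x y) (L x (Suc y))" if "x < w" "y < n" for x y
  proof (cases "\<delta> (qs y)")
    case Stop
    then show ?thesis using step[OF that(2)] by simp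
  next
    case (Add i q')
    with step[OF that(2)] have "qs (Suc y) = q'" and s': "s (Suc y) = (s y)(i := Suc (s y i))" by auto
    then show ?thesis using Add that by (auto simp: V_def L_def s')
  next
    case (Sub i q')
    with step[OF that(2)] have "qs (Suc y) = q'" and s': "s (Suc y) = (s y)(i := s y i - 1)" by auto
    then show ?thesis using Sub that by (auto simp: V_def L_def s')
  next
    case (Test i q' q'')
    then show ?thesis using step[OF that(2)] that regs[of "qs y"] Q[of y] by (auto simp: V_def L_def)
  qed
  have H: "H (L x y) (L (Suc x) y)" if "Suc x < w" for x y
    using that by (auto simp: H_def L_def Suc_le_eq)
  have "tiling m w (Suc n) L"
    unfolding tiling_def
  proof (intro conjI allI impI)
    show "m < w" using w[of 0 1] B_gt by (simp add: s0)
    show "Suc 0 \<in> here (L i 0) \<longleftrightarrow> i < m" if "i \<le> m" for i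
      using B_gt by (simp add: L_def s0)
  qed (use A H V in \<open>auto simp: L_def\<close>)
  then show ?thesis by blast
qed

text \<open>Row by row from below, the tiles of a row represent the configuration that the machine has reached. In the bottom row
this uses that the input flags end at column \<open>m\<close> and, by \<open>H\<close>, do not start again further right.\<close>

lemma halts_if_tiling:
  assumes "tiling m w h L"
  shows "\<exists>q t. ((q\<^sub>0, (\<lambda>_. 0)(1 := m)), (q, t)) \<in> (cm_rel \<delta>)\<^sup>* \<and> \<delta> q = Stop \<and> 0 < t 0"
proof -
  have wh: "m < w" "0 < h" and inp: "\<And>i. i \<le> m \<Longrightarrow> 1 \<in> here (L i 0) \<longleftrightarrow> i < m"
    using assms by (auto simp: tiling_def)
  have L: "L x y \<in> tiles" "lft (L x y) \<longleftrightarrow> x = 0" "rgt (L x y) \<longleftrightarrow> Suc x = w"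
    "lwr (L x y) \<longleftrightarrow> y = 0" "upr (L x y) \<longleftrightarrow> Suc y = h" if "x < w" "y < h" for x y
    using assms that by (auto simp: tiling_def)
  have LH: "H (L x y) (L (Suc x) y)" if "Suc x < w" "y < h" for x y
    using assms that by (auto simp: tiling_def)
  have LV: "V (L x y) (L x (Suc y))" if "x < w" "Suc y < h" for x y
    using assms that by (auto simp: tiling_def)
  define rep where "rep y q s \<longleftrightarrow> (\<forall>x<w. ctrl (L x y) = q \<and> here (L x y) = {i. i < B \<and> x < s i})"
    for y q and s :: "nat \<Rightarrow> nat"
  have ctrl_row: "ctrl (L x y) = ctrl (L 0 y)" if "x < w" "y < h" for x y
    using that
  proof (induction x)
    case (Suc x)
    then show ?case using LH[of x y] by (auto simp: H_def)
  qed simp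
  have "\<exists>q s. ((q\<^sub>0, (\<lambda>_. 0)(1 := m)), (q, s)) \<in> (cm_rel \<delta>)\<^sup>* \<and> rep y q s" if "y < h" for y
    using that
  proof (induction y)
    case 0
    have mono: "1 \<notin> here (L x 0)" if "m \<le> x" "x < w" for x
      using that
    proof (induction rule: dec_induct)
      case base
      then show ?case using inp[of m] by simp
    next
      case (step x)
      then show ?case using LH[of x 0] L(1)[of "Suc x" 0] wh by (auto simp: H_def tiles_def)
    qed
    have "here (L x 0) = {i. i < B \<and> x < ((\<lambda>_. 0)(1 := m)) i}" if "x < w" for x
      using L[of x 0] that wh inp[of x] mono[of x] B_gt
      by (cases "x < m") (auto simp: tiles_def split: if_splits)
    moreover have "ctrl (L x 0) = q\<^sub>0" if "x < w" for x
      using L[of x 0] that wh by (auto simp: tiles_def)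
    ultimately have "rep 0 q\<^sub>0 ((\<lambda>_. 0)(1 := m))" by (simp add: rep_def)
    then show ?case by blast
  next
    case (Suc y)
    then obtain q s where run: "((q\<^sub>0, (\<lambda>_. 0)(1 := m)), (q, s)) \<in> (cm_rel \<delta>)\<^sup>*" and rep: "rep y q s"
      using Suc_lessD by blast
    have ctrl: "ctrl (L x y) = q" and here: "here (L x y) = {i. i < B \<and> x < s i}" if "x < w" for x
      using rep that by (auto simp: rep_def)
    have prev: "prev (L x y) = {i. i < B \<and> x \<le> s i}" if "x < w" for x
    proof (cases x)
      case 0
      then show ?thesis using L[of x y] that Suc by (auto simp: tiles_def)
    next
      case x: (Suc x')
      then have "prev (L x y) = here (L x' y)" using LH[of x' y] that Suc by (simp add: H_def)
      then show ?thesis using here[of x'] x that by (simp add: Suc_le_eq)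
    qed
    have nxt: "nxt (L x y) = {i. i < B \<and> Suc x < s i}" if "x < w" for x
    proof (cases "Suc x = w")
      case True
      then have "here (L x y) = {}" "nxt (L x y) = {}"
        using L[of x y] that Suc by (auto simp: tiles_def)
      then show ?thesis using here[OF that] by auto
    next
      case False
      then show ?thesis using LH[of x y] that Suc here[of "Suc x"] by (auto simp: H_def)
    qed
    have "q \<in> Q" using L(1)[of 0 y] ctrl[of 0] wh Suc by (auto simp: tiles_def)
    have w0: "0 < w" using wh by simp
    have V: "V (L x y) (L x (Suc y))" if "x < w" for x using LV that Suc by auto
    have "\<exists>q' s'. cm_step \<delta> (q, s) = Some (q', s') \<and> rep (Suc y) q' s'"
    proof (cases "\<delta> q")
      case Stop
      then show ?thesis using V[OF w0] ctrl[OF w0] by (simp add: V_def)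
    next
      case (Add i q')
      then have "rep (Suc y) q' (s(i := Suc (s i)))"
        using V ctrl here prev by (auto simp: V_def rep_def)
      then show ?thesis using Add by simp
    next
      case (Sub i q')
      then have "rep (Suc y) q' (s(i := s i - 1))"
        using V ctrl here nxt by (auto simp: V_def rep_def)
      then show ?thesis using Sub by simp
    next
      case (Test i q' q'')
      have "i < B" using regs[OF \<open>q \<in> Q\<close>] Test by simp
      have "ctrl (L x (Suc y)) = (if s i = 0 then q' else q'')" if "x < w" for x
        using ctrl_row[OF that Suc.prems] V[OF w0] ctrl[OF w0] here[OF w0] Test \<open>i < B\<close>
          L(2)[of 0 y] w0 Suc.prems by (auto simp: V_def)
      moreover have "here (L x (Suc y)) = {i. i < B \<and> x < s i}" if "x < w" for x
        using V[OF that] ctrl[OF that] here[OF that] Test by (auto simp: V_def)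
      ultimately have "rep (Suc y) (if s i = 0 then q' else q'') s" by (simp add: rep_def)
      then show ?thesis using Test by simp
    qed
    then obtain q' s' where "((q, s), (q', s')) \<in> cm_rel \<delta>" "rep (Suc y) q' s'"
      by (auto simp: cm_rel_def)
    with run show ?case by (meson rtrancl_into_rtrancl)
  qed
  from this[of "h - 1"] wh obtain q s where *: "((q\<^sub>0, (\<lambda>_. 0)(1 := m)), (q, s)) \<in> (cm_rel \<delta>)\<^sup>*"
    "rep (h - 1) q s" by auto
  have "\<delta> q = Stop" "0 < s 0"
    using L[of 0 "h - 1"] *(2) wh by (auto simp: tiles_def rep_def)
  then show ?thesis using *(1) by blast
qed

theorem tiling_iff_halts:
  "(\<exists>w h L. tiling m w h L) \<longleftrightarrow>
   (\<exists>q t. ((q\<^sub>0, (\<lambda>_. 0)(1 := m)), (q, t)) \<in> (cm_rel \<delta>)\<^sup>* \<and> \<delta> q = Stop \<and> 0 < t 0)"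
  using tiling_if_halts halts_if_tiling by blast

end

section \<open>Tilings inside a freezing automaton\<close>

text \<open>Used to follow tiles in one direction until the frame is met: \<open>P i\<close> says that there is a tile after \<open>i\<close> steps and
\<open>E i\<close> that it lies on the edge.\<close>

lemma first_exit:
  assumes "P 0" "\<And>i. P i \<Longrightarrow> \<not> E i \<Longrightarrow> P (Suc i)" "\<not> P j"
  shows "\<exists>n. (\<forall>i\<le>n. P i) \<and> E n \<and> (\<forall>i<n. \<not> E i)"
proof -
  have "\<exists>n. E n \<and> P n"
  proof (rule ccontr)
    assume "\<nexists>n. E n \<and> P n"
    then have "P i" for i by (induction i) (use assms(1,2) in auto)
    then show False using assms(3) by simp
  qed
  then obtain n where n: "E n" "\<forall>i<n. \<not> (E i \<and> P i)"
    using exists_least_iff[of "\<lambda>n. E n \<and> P n"] by blast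
  have "P i" if "i \<le> n" for i
    using that
  proof (induction i)
    case (Suc i)
    then show ?case using assms(2)[of i] n(2) by (auto simp: Suc_le_eq)
  qed (rule assms(1))
  then show ?thesis using n by (metis less_imp_le)
qed

context tile_system
begin

text \<open>The first two bits are those that \<open>tile_rule\<close> looks up in a word; the others identify the tile by its number in an
enumeration.\<close>

definition data_bit :: "'a \<Rightarrow> nat \<Rightarrow> bool" where
  "data_bit a j = (case j of 0 \<Rightarrow> inp a | Suc 0 \<Rightarrow> lft a \<and> lwr a | Suc (Suc i) \<Rightarrow> to_nat_on A a = i)"

text \<open>Three symbols at the beginning and two for each of the \<open>card A + 2\<close> data bits; the length is odd, so that the last
position, being even, carries the separator 1.\<close>

definition K :: nat where "K = 2 * card A + 7"

text \<open>A word is \<open>0 0 1 d\<^sub>0 1 d\<^sub>1 1 \<dots> 1\<close>. Two consecutive zeros occur only at its beginning and its last symbol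
is 1, which makes proper overlaps of words impossible.\<close>

definition word :: "'a \<Rightarrow> nat \<Rightarrow> bool" where
  "word a i \<longleftrightarrow> 2 \<le> i \<and> (even i \<or> data_bit a ((i - 3) div 2))"

lemma word_simps: "\<not> word a 0" "\<not> word a (Suc 0)" "word a 3 \<longleftrightarrow> inp a" "word a 5 \<longleftrightarrow> lft a \<and> lwr a"
  by (auto simp: word_def data_bit_def)

lemma word_inject:
  assumes "a \<in> A" "c \<in> A" "\<forall>i<K. word a i = word c i" shows "a = c"
proof -
  have bij: "bij_betw (to_nat_on A) A {..<card A}" by (rule to_nat_on_finite[OF finite_A])
  have "word b (2 * i + 7) \<longleftrightarrow> to_nat_on A b = i" for b i
    by (auto simp: word_def data_bit_def)
  moreover have "2 * to_nat_on A a + 7 < K" using bij assms(1) by (auto simp: K_def bij_betw_def)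
  ultimately have "to_nat_on A c = to_nat_on A a" using assms(3) by blast
  then show ?thesis using bij assms(1,2) by (auto simp: bij_betw_def inj_on_def)
qed

definition reads :: "config \<Rightarrow> cell \<Rightarrow> 'a \<Rightarrow> bool" where
  "reads x = (\<lambda>(p, y) a. a \<in> A \<and> (\<forall>i<K. x (p + int i, y) \<longleftrightarrow> word a i))"

lemma reads_unique: "reads x v a \<Longrightarrow> reads x v c \<Longrightarrow> a = c"
  by (cases v) (auto simp: reads_def intro!: word_inject)

lemma reads_False: "reads x v a \<Longrightarrow> \<not> x v"
  by (cases v) (auto simp: reads_def K_def word_simps dest!: spec[of _ 0])

text \<open>The two zeros at the start of the second word would have to lie inside the first one.\<close>

lemma no_overlap:
  assumes "reads x (p, y) a" "reads x (p + int j, y) c" "j < K" shows "j = 0"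
proof (rule ccontr)
  assume j: "j \<noteq> 0"
  have "1 < K" by (simp add: K_def)
  then have "\<not> x (p + int j, y)" "\<not> x (p + int (Suc j), y)"
    using assms(2) word_simps(1,2)[of c] unfolding reads_def
    by (auto dest: spec[of _ 0] spec[of _ 1] simp: algebra_simps)
  then have 1: "\<not> word a j" "Suc j < K \<longrightarrow> \<not> word a (Suc j)"
    using assms(1,3) by (auto simp: reads_def)
  show False
  proof (cases "even j")
    case True
    then show ?thesis using 1(1) j by (auto simp: word_def)
  next
    case False
    moreover have "j \<noteq> K - 1" using False 1(1) j by (auto simp: K_def)
    ultimately show ?thesis using 1(2) assms(3) j by (auto simp: word_def)
  qed
qed

definition good :: "config \<Rightarrow> cell \<Rightarrow> 'a \<Rightarrow> bool" where
  "good x = (\<lambda>(p, y) a. reads x (p, y) a \<and>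
     (\<not> lft a \<longrightarrow> (\<exists>c. reads x (p - int K, y) c \<and> H c a)) \<and>
     (\<not> rgt a \<longrightarrow> (\<exists>c. reads x (p + int K, y) c \<and> H a c)) \<and>
     (\<not> lwr a \<longrightarrow> (\<exists>c. reads x (p, y - 1) c \<and> V c a)) \<and>
     (\<not> upr a \<longrightarrow> (\<exists>c. reads x (p, y + 1) c \<and> V a c)))"

text \<open>What \<open>tile_rule\<close> asks of the surroundings of a word: \<open>good\<close> is the part that can be seen in a window, and the last
conjunct is the test of the input.\<close>

definition legal :: "nat \<Rightarrow> config \<Rightarrow> cell \<Rightarrow> 'a \<Rightarrow> bool" where
  "legal m x = (\<lambda>(p, y) a. good x (p, y) a \<and>
     (lft a \<and> lwr a \<longrightarrow> (\<forall>i\<le>m. x (p + int (i * K + 3), y) \<longleftrightarrow> i < m)))"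

definition unfold_window :: "nat \<Rightarrow> config" where
  "unfold_window W = (\<lambda>(a, b). nat (3 * (a + int K) + (b + 1)) \<in> set_decode W)"

definition S :: nat where
  "S = set_encode {W. W < 2 ^ (9 * K) \<and> (\<exists>a. good (unfold_window W) (0, 0) a)}"

lemma unfold_window:
  assumes "- int K \<le> a" "a < 2 * int K" "- 1 \<le> b" "b \<le> 1"
  shows "unfold_window (window K j x) (a, b) = x (a - int j, b)"
proof -
  define e where "e = nat (3 * (a + int K) + (b + 1))"
  have ie: "int e = 3 * (a + int K) + (b + 1)" using assms by (simp add: e_def)
  have "int e div 3 = a + int K" using assms(3,4) unfolding ie by presburger
  then have d: "int (e div 3) = a + int K" by (simp add: zdiv_int)
  have "int (e mod 3) = int e - 3 * int (e div 3)" by (simp add: zmod_int zdiv_int minus_mult_div_eq_mod)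
  then have m: "int (e mod 3) = b + 1" using d ie by simp
  have "a + 1 \<le> 2 * int K" using assms(2) by simp
  then have "3 * (a + int K) + (b + 1) < 9 * int K" using assms(4) by (simp add: algebra_simps)
  then have "int e < int (9 * K)" unfolding ie by simp
  then have "e < 9 * K" by linarith
  then show ?thesis unfolding unfold_window_def window_def prod.case e_def[symmetric]
    by (simp add: d m)
qed

text \<open>\<open>good\<close> inspects only the window, hence it can be tabulated in the finite set \<open>S\<close>.\<close>

lemma good_unfold_window: "good (unfold_window (window K j x)) (0, 0) a \<longleftrightarrow> good x (- int j, 0) a"
proof -
  have "reads (unfold_window (window K j x)) (p, b) c \<longleftrightarrow> reads x (p - int j, b) c"
    if "p \<in> {- int K, 0, int K}" "b \<in> {- 1, 0, 1}" for p b c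
  proof -
    have "unfold_window (window K j x) (p + int i, b) = x (p + int i - int j, b)" if "i < K" for i
      using that \<open>p \<in> _\<close> \<open>b \<in> _\<close> by (intro unfold_window) auto
    then show ?thesis by (auto simp: reads_def algebra_simps)
  qed
  from this[of 0 0] this[of "- int K" 0] this[of "int K" 0] this[of 0 "-1"] this[of 0 1]
  moreover have "- int K - int j = - int j - int K" by simp
  ultimately show ?thesis by (simp add: good_def)
qed

lemma window_in_S: "window K j x \<in> set_decode S \<longleftrightarrow> (\<exists>a. good x (- int j, 0) a)"
proof -
  have "window K j x < 2 ^ (9 * K)" unfolding window_def by (subst set_encode_less_iff) auto
  then show ?thesis unfolding S_def by (subst set_encode_inverse) (auto simp: good_unfold_window)
qed

definition ca :: "nat \<Rightarrow> config \<Rightarrow> config" where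
  "ca m = ca_map (nbhd K m) (tile_rule K S m)"

lemma good_shift: "good (\<lambda>n. x (v + n)) w a \<longleftrightarrow> good x (v + w) a"
  by (cases v; cases w) (simp add: good_def reads_def algebra_simps)

lemma ca_iff:
  "ca m x (u, y) \<longleftrightarrow> x (u, y) \<or> \<not> (\<exists>j<K. \<exists>a. legal m x (u - int j, y) a)"
proof -
  let ?q = "\<lambda>n. x ((u, y) + n)"
  have "ca m x (u, y) = tile_rule K S m ?q"
    unfolding ca_def ca_map_def by (rule tile_rule_cong) simp
  also have "\<dots> \<longleftrightarrow> x (u, y) \<or> \<not> (\<exists>j<K. (\<exists>a. good x (u - int j, y) a) \<and> (x (u - int j + 5, y) \<longrightarrow>
      (\<forall>i\<le>m. x (u - int j + int (i * K + 3), y) \<longleftrightarrow> i < m)))"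
    unfolding tile_rule_def window_in_S good_shift by (simp add: less_Suc_eq_le algebra_simps)
  also have "\<dots> \<longleftrightarrow> x (u, y) \<or> \<not> (\<exists>j<K. \<exists>a. legal m x (u - int j, y) a)"
  proof -
    have "x (p + 5, y) \<longleftrightarrow> lft a \<and> lwr a" if "good x (p, y) a" for p a
    proof -
      have "5 < K" by (simp add: K_def)
      with that have "x (p + int 5, y) \<longleftrightarrow> word a 5" unfolding good_def reads_def by blast
      then show ?thesis by (simp add: word_simps)
    qed
    then have "(\<exists>a. good x (p, y) a) \<and> (x (p + 5, y) \<longrightarrow> (\<forall>i\<le>m. x (p + int (i * K + 3), y) \<longleftrightarrow> i < m))
        \<longleftrightarrow> (\<exists>a. legal m x (p, y) a)" for p
      unfolding legal_def by blast
    then show ?thesis by simp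
  qed
  finally show ?thesis .
qed

text \<open>A 0 in a fixed point lies in a legal word. Its neighbouring words start with 0 and hence lie in legal words
themselves, and these are the neighbours because words do not overlap. So from a tile one can pass to a matching
tile in every direction that is not blocked by an edge, and since \<open>ones\<close> excludes an infinite sequence of tiles,
the edges are met. Going left and then right yields a complete row of a frame; because \<open>H\<close> and \<open>V\<close> propagate the
edge markings, whole rows can be followed down to the bottom edge and then up to the top edge.\<close>

lemma tiling_of_fixed_point:
  assumes fixed: "ca m x = x" and zero: "\<not> x v"
    and ones: "\<And>v d. d \<noteq> 0 \<Longrightarrow> \<exists>i::nat. x (fst v + int i * fst d, snd v + int i * snd d)"
  shows "\<exists>w h L. tiling m w h L"
proof -
  \<comment> \<open>the first cell of the word is 0, hence lies in some legal word, which must be this word\<close>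
  have legal: "legal m x (p, y) a" if "reads x (p, y) a" for p y a
  proof -
    have "\<not> ca m x (p, y)" using reads_False[OF that] fixed by simp
    then obtain j c where j: "j < K" "legal m x (p - int j, y) c" by (auto simp: ca_iff)
    then have "reads x (p - int j, y) c" by (simp add: legal_def good_def)
    then have "j = 0" using no_overlap[of x "p - int j" y c j a] that j(1) by simp
    with j(2) that show ?thesis
      using reads_unique[of x "(p, y)" a c] by (auto simp: legal_def good_def)
  qed
  have nb: "\<not> lft a \<Longrightarrow> \<exists>c. reads x (p - int K, y) c \<and> H c a"
    "\<not> rgt a \<Longrightarrow> \<exists>c. reads x (p + int K, y) c \<and> H a c"
    "\<not> lwr a \<Longrightarrow> \<exists>c. reads x (p, y - 1) c \<and> V c a"
    "\<not> upr a \<Longrightarrow> \<exists>c. reads x (p, y + 1) c \<and> V a c" if "reads x (p, y) a" for p y a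
    using legal[OF that] by (auto simp: legal_def good_def)
  have Kpos: "int K \<noteq> 0" by (simp add: K_def)
  have gap: "\<exists>i. \<forall>a. \<not> reads x (p + int i * int K, y) a" "\<exists>i. \<forall>a. \<not> reads x (p - int i * int K, y) a"
    "\<exists>i. \<forall>a. \<not> reads x (p, y + int i) a" "\<exists>i. \<forall>a. \<not> reads x (p, y - int i) a" for p y
  proof -
    obtain i where "x (p + int i * int K, y)" using ones[of "(int K, 0)" "(p, y)"] Kpos
      by (auto simp: zero_prod_def)
    then show "\<exists>i. \<forall>a. \<not> reads x (p + int i * int K, y) a" using reads_False by blast
    obtain i where "x (p - int i * int K, y)" using ones[of "(- int K, 0)" "(p, y)"] Kpos
      by (auto simp: zero_prod_def)
    then show "\<exists>i. \<forall>a. \<not> reads x (p - int i * int K, y) a" using reads_False by blast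
    obtain i where "x (p, y + int i)" using ones[of "(0, 1)" "(p, y)"]
      by (auto simp: zero_prod_def)
    then show "\<exists>i. \<forall>a. \<not> reads x (p, y + int i) a" using reads_False by blast
    obtain i where "x (p, y - int i)" using ones[of "(0, - 1)" "(p, y)"]
      by (auto simp: zero_prod_def)
    then show "\<exists>i. \<forall>a. \<not> reads x (p, y - int i) a" using reads_False by blast
  qed

  obtain p0 y0 a0 where start: "reads x (p0, y0) a0"
  proof -
    obtain u y where v: "v = (u, y)" by (cases v)
    have "\<not> ca m x (u, y)" using zero fixed v by simp
    then show ?thesis using that by (auto simp: ca_iff legal_def good_def)
  qed

  \<comment> \<open>the left edge in the row of the given tile\<close>
  obtain p1 where p1: "\<exists>a. reads x (p1, y0) a \<and> lft a"
  proof -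
    let ?P = "\<lambda>i. \<exists>a. reads x (p0 - int i * int K, y0) a"
    let ?E = "\<lambda>i. \<exists>a. reads x (p0 - int i * int K, y0) a \<and> lft a"
    obtain j where j: "\<not> ?P j" using gap(2) by blast
    have left: "?P (Suc i)" if "?P i" "\<not> ?E i" for i
    proof -
      obtain a where "reads x (p0 - int i * int K, y0) a" "\<not> lft a" using \<open>?P i\<close> \<open>\<not> ?E i\<close> by blast
      moreover have "p0 - int (Suc i) * int K = p0 - int i * int K - int K" by (simp add: algebra_simps)
      ultimately show ?thesis using nb(1) by metis
    qed
    have "?P 0" using start by (intro exI[of _ a0]) simp
    from first_exit[of ?P ?E, OF this left j] obtain n where "?E n" by blast
    then show ?thesis using that by blast
  qed
  \<comment> \<open>the right edge, reached from the left one\<close>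
  obtain w where w: "0 < w" "\<And>i. i < w \<Longrightarrow>
    \<exists>a. reads x (p1 + int i * int K, y0) a \<and> (lft a \<longleftrightarrow> i = 0) \<and> (rgt a \<longleftrightarrow> Suc i = w)"
  proof -
    let ?P = "\<lambda>i. \<exists>a. reads x (p1 + int i * int K, y0) a \<and> (lft a \<longleftrightarrow> i = 0)"
    let ?E = "\<lambda>i. \<exists>a. reads x (p1 + int i * int K, y0) a \<and> rgt a"
    obtain j where "\<forall>a. \<not> reads x (p1 + int j * int K, y0) a" using gap(1) by blast
    then have j: "\<not> ?P j" by simp
    have right: "?P (Suc i)" if "?P i" "\<not> ?E i" for i
    proof -
      obtain a where a: "reads x (p1 + int i * int K, y0) a" "\<not> rgt a" using \<open>?P i\<close> \<open>\<not> ?E i\<close> by blast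
      have eq: "p1 + int (Suc i) * int K = p1 + int i * int K + int K" by (simp add: algebra_simps)
      obtain c where "reads x (p1 + int (Suc i) * int K, y0) c" "H a c" unfolding eq using nb(2)[OF a] by blast
      then show ?thesis using H_sides by blast
    qed
    obtain a where "reads x (p1, y0) a" "lft a" using p1 by blast
    then have "?P 0" by (intro exI[of _ a]) simp
    from first_exit[of ?P ?E, OF this right j]
    obtain n where n: "\<forall>i\<le>n. ?P i" "?E n" "\<forall>i<n. \<not> ?E i" by blast
    show ?thesis
    proof (rule that[of "Suc n"])
      fix i assume "i < Suc n"
      then have "i \<le> n" by simp
      then obtain a where a: "reads x (p1 + int i * int K, y0) a" "lft a \<longleftrightarrow> i = 0" using n(1) by blast
      have "rgt a \<longleftrightarrow> ?E i" using a(1) reads_unique by blast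
      also have "\<dots> \<longleftrightarrow> i = n" using n(2,3) \<open>i \<le> n\<close> by (metis le_neq_implies_less)
      finally have "rgt a \<longleftrightarrow> i = n" .
      then show "\<exists>a. reads x (p1 + int i * int K, y0) a \<and> (lft a \<longleftrightarrow> i = 0) \<and> (rgt a \<longleftrightarrow> Suc i = Suc n)"
        using a by auto
    qed simp
  qed

  define Row where "Row y \<longleftrightarrow> (\<forall>i<w. \<exists>a. reads x (p1 + int i * int K, y) a \<and>
      (lft a \<longleftrightarrow> i = 0) \<and> (rgt a \<longleftrightarrow> Suc i = w))" for y
  have Row_H: "H a c" if "Row y" "Suc i < w" "reads x (p1 + int i * int K, y) a"
    "reads x (p1 + int (Suc i) * int K, y) c" for y i a c
  proof -
    obtain b where b: "reads x (p1 + int i * int K, y) b" "rgt b \<longleftrightarrow> Suc i = w"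
      using \<open>Row y\<close> \<open>Suc i < w\<close> unfolding Row_def by (meson Suc_lessD)
    then have "\<not> rgt a" using that(2) reads_unique[OF b(1) that(3)] by simp
    from nb(2)[OF that(3) this] obtain d where "reads x (p1 + int i * int K + int K, y) d" "H a d" by blast
    moreover have "p1 + int i * int K + int K = p1 + int (Suc i) * int K" by (simp add: algebra_simps)
    ultimately show ?thesis using that(4) reads_unique by metis
  qed
  have Row_edges: "(upr a \<longleftrightarrow> upr c) \<and> (lwr a \<longleftrightarrow> lwr c)" if "Row y" "i < w"
    "reads x (p1, y) a" "reads x (p1 + int i * int K, y) c" for y i a c
    using that(2,4)
  proof (induction i arbitrary: c)
    case 0
    then have "reads x (p1, y) c" by simp
    then show ?case using reads_unique[OF that(3)] by blast
  next
    case (Suc i)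
    obtain d where d: "reads x (p1 + int i * int K, y) d" using \<open>Row y\<close> Suc.prems(1)
      unfolding Row_def by (meson Suc_lessD)
    then have "H d c" using Row_H[OF \<open>Row y\<close> Suc.prems(1)] Suc.prems(2) by blast
    then show ?case using Suc.IH[OF _ d] Suc.prems(1) H_sides[of d c] by simp
  qed
  have "Row y0" using w(2) by (simp add: Row_def)
  have Row_0: "\<exists>a. reads x (p1, y) a" if "Row y" for y
    using that w(1) unfolding Row_def by (auto dest!: spec[of _ 0])
  have Row_up: "Row (y + 1)" if "Row y" "reads x (p1, y) a" "\<not> upr a" for y a
    unfolding Row_def
  proof (intro allI impI)
    fix i assume i: "i < w"
    then obtain c where c: "reads x (p1 + int i * int K, y) c" "lft c \<longleftrightarrow> i = 0" "rgt c \<longleftrightarrow> Suc i = w"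
      using \<open>Row y\<close> unfolding Row_def by blast
    then have "\<not> upr c" using Row_edges[OF that(1) i that(2) c(1)] that(3) by simp
    from nb(4)[OF c(1) this] obtain d where d: "reads x (p1 + int i * int K, y + 1) d" "V c d" by blast
    show "\<exists>a. reads x (p1 + int i * int K, y + 1) a \<and> (lft a \<longleftrightarrow> i = 0) \<and> (rgt a \<longleftrightarrow> Suc i = w)"
      using c(2,3) d(1) V_sides[OF d(2)] by (intro exI[of _ d]) simp
  qed
  have Row_down: "Row (y - 1)" if "Row y" "reads x (p1, y) a" "\<not> lwr a" for y a
    unfolding Row_def
  proof (intro allI impI)
    fix i assume i: "i < w"
    then obtain c where c: "reads x (p1 + int i * int K, y) c" "lft c \<longleftrightarrow> i = 0" "rgt c \<longleftrightarrow> Suc i = w"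
      using \<open>Row y\<close> unfolding Row_def by blast
    then have "\<not> lwr c" using Row_edges[OF that(1) i that(2) c(1)] that(3) by simp
    from nb(3)[OF c(1) this] obtain d where d: "reads x (p1 + int i * int K, y - 1) d" "V d c" by blast
    show "\<exists>a. reads x (p1 + int i * int K, y - 1) a \<and> (lft a \<longleftrightarrow> i = 0) \<and> (rgt a \<longleftrightarrow> Suc i = w)"
      using c(2,3) d(1) V_sides[OF d(2)] by (intro exI[of _ d]) simp
  qed

  \<comment> \<open>the bottom edge, and then the top edge\<close>
  obtain y1 where y1: "Row y1" "\<exists>a. reads x (p1, y1) a \<and> lwr a"
  proof -
    let ?P = "\<lambda>j. Row (y0 - int j)" and ?E = "\<lambda>j. \<exists>a. reads x (p1, y0 - int j) a \<and> lwr a"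
    obtain j where "\<forall>a. \<not> reads x (p1, y0 - int j) a" using gap(4) by blast
    then have j: "\<not> ?P j" using Row_0[of "y0 - int j"] by auto
    have down: "?P (Suc i)" if "?P i" "\<not> ?E i" for i
    proof -
      obtain a where a: "reads x (p1, y0 - int i) a" using Row_0[OF \<open>?P i\<close>] by blast
      have "y0 - int (Suc i) = y0 - int i - 1" by simp
      then show ?thesis using Row_down[OF that(1) a] that(2) a by metis
    qed
    have "?P 0" using \<open>Row y0\<close> by simp
    from first_exit[of ?P ?E, OF this down j] obtain n where "?P n" "?E n" by blast
    then show ?thesis using that by blast
  qed
  obtain h where h: "0 < h" "\<And>j. j < h \<Longrightarrow> Row (y1 + int j)"
    "\<And>j a. j < h \<Longrightarrow> reads x (p1, y1 + int j) a \<Longrightarrow> (lwr a \<longleftrightarrow> j = 0) \<and> (upr a \<longleftrightarrow> Suc j = h)"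
  proof -
    let ?P = "\<lambda>j. Row (y1 + int j) \<and> (\<exists>a. reads x (p1, y1 + int j) a \<and> (lwr a \<longleftrightarrow> j = 0))"
    let ?E = "\<lambda>j. \<exists>a. reads x (p1, y1 + int j) a \<and> upr a"
    obtain j where "\<forall>a. \<not> reads x (p1, y1 + int j) a" using gap(3) by blast
    then have j: "\<not> ?P j" by simp
    have up: "?P (Suc i)" if P: "?P i" "\<not> ?E i" for i
    proof -
      obtain a where a: "reads x (p1, y1 + int i) a" "\<not> upr a" using P by blast
      have eq: "y1 + int (Suc i) = y1 + int i + 1" by simp
      have "Row (y1 + int (Suc i))" unfolding eq using Row_up P a by blast
      moreover have "\<exists>c. reads x (p1, y1 + int (Suc i)) c \<and> \<not> lwr c"
        unfolding eq using nb(4)[OF a] V_sides by metis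
      ultimately show ?thesis by simp
    qed
    have "?P 0" using y1 by simp
    from first_exit[of ?P ?E, OF this up j]
    obtain n where n: "\<forall>i\<le>n. ?P i" "?E n" "\<forall>i<n. \<not> ?E i" by blast
    show ?thesis
    proof (rule that[of "Suc n"])
      fix j a assume j: "j < Suc n" and a: "reads x (p1, y1 + int j) a"
      have "j \<le> n" using j by simp
      then obtain b where "reads x (p1, y1 + int j) b" "lwr b \<longleftrightarrow> j = 0" using n(1) by blast
      then have "lwr a \<longleftrightarrow> j = 0" using reads_unique[OF a] by blast
      moreover have "upr a \<longleftrightarrow> ?E j" using a reads_unique by blast
      moreover have "?E j \<longleftrightarrow> j = n" using n(2,3) \<open>j \<le> n\<close> by (metis le_neq_implies_less)
      ultimately show "(lwr a \<longleftrightarrow> j = 0) \<and> (upr a \<longleftrightarrow> Suc j = Suc n)" by simp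
    qed (use n(1) in auto)
  qed

  define L where "L i j = (SOME a. reads x (p1 + int i * int K, y1 + int j) a)" for i j
  have L: "reads x (p1 + int i * int K, y1 + int j) (L i j)" if "i < w" "j < h" for i j
  proof -
    have "\<exists>a. reads x (p1 + int i * int K, y1 + int j) a"
      using h(2)[OF that(2)] that(1) by (auto simp: Row_def)
    then show ?thesis unfolding L_def by (rule someI_ex)
  qed
  have L_lr: "lft (L i j) \<longleftrightarrow> i = 0" "rgt (L i j) \<longleftrightarrow> Suc i = w" if "i < w" "j < h" for i j
  proof -
    obtain a where a: "reads x (p1 + int i * int K, y1 + int j) a" "lft a \<longleftrightarrow> i = 0" "rgt a \<longleftrightarrow> Suc i = w"
      using h(2)[OF \<open>j < h\<close>] \<open>i < w\<close> by (auto simp: Row_def)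
    then show "lft (L i j) \<longleftrightarrow> i = 0" "rgt (L i j) \<longleftrightarrow> Suc i = w"
      using reads_unique[OF L[OF that] a(1)] by auto
  qed
  have L_ud: "lwr (L i j) \<longleftrightarrow> j = 0" "upr (L i j) \<longleftrightarrow> Suc j = h" if "i < w" "j < h" for i j
  proof -
    have 0: "reads x (p1, y1 + int j) (L 0 j)" using L[OF w(1) that(2)] by simp
    show "lwr (L i j) \<longleftrightarrow> j = 0" "upr (L i j) \<longleftrightarrow> Suc j = h"
      using Row_edges[OF h(2)[OF that(2)] that(1) 0 L[OF that]] h(3)[OF that(2) 0] by auto
  qed
  have inp: "x (p1 + int (i * K + 3), y1) \<longleftrightarrow> inp (L i 0)" if "i < w" for i
  proof -
    have "3 < K" by (simp add: K_def)
    then have "x (p1 + int i * int K + int 3, y1) \<longleftrightarrow> word (L i 0) 3"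
      using L[OF that h(1)] unfolding reads_def by auto
    then show ?thesis by (simp add: word_simps algebra_simps)
  qed
  have chk: "x (p1 + int (i * K + 3), y1) \<longleftrightarrow> i < m" if "i \<le> m" for i
    using legal[OF L[OF w(1) h(1)]] L_lr[OF w(1) h(1)] L_ud[OF w(1) h(1)] that by (simp add: legal_def)
  \<comment> \<open>the input fits into the frame, for the tile on the right edge carries no input flag\<close>
  have "m < w"
  proof (rule ccontr)
    assume "\<not> m < w"
    then have "inp (L (w - 1) 0)" using inp[of "w - 1"] chk[of "w - 1"] w(1) by simp
    moreover have "L (w - 1) 0 \<in> A" using L[of "w - 1" 0] w(1) h(1) by (auto simp: reads_def)
    ultimately show False using rgt_no_inp L_lr(2)[of "w - 1" 0] w(1) h(1) by simp
  qed
  have "tiling m w h L"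
    unfolding tiling_def
  proof (intro conjI allI impI)
    fix i j assume ij: "i < w" "j < h"
    show "L i j \<in> A" using L[OF ij] by (auto simp: reads_def)
    show "H (L i j) (L (Suc i) j)" if "Suc i < w"
      using Row_H[OF h(2)[OF ij(2)] that L[OF ij] L[OF that ij(2)]] .
    show "V (L i j) (L i (Suc j))" if "Suc j < h"
    proof -
      have "\<not> upr (L i j)" using L_ud(2)[OF ij] that by simp
      from nb(4)[OF L[OF ij] this] obtain c where
        "reads x (p1 + int i * int K, y1 + int (Suc j)) c" "V (L i j) c" by (auto simp: algebra_simps)
      then show ?thesis using reads_unique L[OF ij(1) that] by metis
    qed
  qed (use L_lr L_ud \<open>m < w\<close> h(1) inp chk in auto)
  then show ?thesis by blast
qed

text \<open>The rectangle lies in the quadrant of nonnegative coordinates, with its bottom left corner at the origin; the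
values of \<open>picture L\<close> elsewhere are arbitrary.\<close>

definition picture :: "(nat \<Rightarrow> nat \<Rightarrow> 'a) \<Rightarrow> config" where
  "picture L = (\<lambda>(a, b). word (L (nat a div K) (nat b)) (nat a mod K))"

text \<open>Every word of the picture is legal, whatever the configuration is outside the picture: a tile on an edge makes no demand
on the outside, and the input test at the corner stays inside since \<open>m < w\<close>.\<close>

lemma tiling_stable:
  assumes "tiling m w h L" and D: "D = {0..<int (w * K)} \<times> {0..<int h}"
    and x: "x \<in> cylinder D (picture L)"
  shows "ca m x \<in> cylinder D (picture L)"
proof -
  have reads: "reads x (int (i * K), int j) (L i j)" if "i < w" "j < h" for i j
  proof -
    have "x (int (i * K) + int e, int j) = word (L i j) e" if "e < K" for e
    proof -
      have "i * K + e < w * K"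
      proof -
        have "i * K + e < Suc i * K" using that by simp
        also have "\<dots> \<le> w * K" using \<open>i < w\<close> by (intro mult_le_mono1) simp
        finally show ?thesis .
      qed
      then have "int (i * K + e) < int (w * K)" by (simp only: of_nat_less_iff)
      then have "(int (i * K) + int e, int j) \<in> D" using \<open>j < h\<close> by (simp add: D)
      then have "x (int (i * K) + int e, int j) = picture L (int (i * K) + int e, int j)"
        using x by (auto simp: cylinder_def)
      also have "\<dots> = word (L i j) e" using that by (simp add: picture_def flip: of_nat_add of_nat_mult)
      finally show ?thesis .
    qed
    moreover have "L i j \<in> A" using assms(1) that by (auto simp: tiling_def)
    ultimately show ?thesis by (simp add: reads_def)
  qed
  have good: "good x (int (i * K), int j) (L i j)" if "i < w" "j < h" for i j
  proof -
    have T: "lft (L i j) \<longleftrightarrow> i = 0" "rgt (L i j) \<longleftrightarrow> Suc i = w" "lwr (L i j) \<longleftrightarrow> j = 0" "upr (L i j) \<longleftrightarrow> Suc j = h"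
      using assms(1) that by (auto simp: tiling_def)
    have TH: "H (L i j) (L (Suc i) j)" if "Suc i < w" "j < h" for i j
      using assms(1) that by (auto simp: tiling_def)
    have TV: "V (L i j) (L i (Suc j))" if "i < w" "Suc j < h" for i j
      using assms(1) that by (auto simp: tiling_def)
    have 1: "reads x (int (i * K) - int K, int j) (L (i - 1) j) \<and> H (L (i - 1) j) (L i j)" if "i \<noteq> 0"
      using that \<open>i < w\<close> \<open>j < h\<close> reads[of "i - 1" j] TH[of "i - 1" j] by (cases i) (auto simp: algebra_simps)
    have 2: "reads x (int (i * K) + int K, int j) (L (Suc i) j) \<and> H (L i j) (L (Suc i) j)" if "Suc i \<noteq> w"
      using that \<open>i < w\<close> \<open>j < h\<close> reads[of "Suc i" j] TH[of i j] by (auto simp: algebra_simps)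
    have 3: "reads x (int (i * K), int j - 1) (L i (j - 1)) \<and> V (L i (j - 1)) (L i j)" if "j \<noteq> 0"
      using that \<open>i < w\<close> \<open>j < h\<close> reads[of i "j - 1"] TV[of i "j - 1"] by (cases j) auto
    have 4: "reads x (int (i * K), int j + 1) (L i (Suc j)) \<and> V (L i j) (L i (Suc j))" if "Suc j \<noteq> h"
      using that \<open>i < w\<close> \<open>j < h\<close> reads[of i "Suc j"] TV[of i j] by (auto simp: algebra_simps)
    show ?thesis unfolding good_def split using reads[OF that] 1 2 3 4 T by blast
  qed
  have legal: "legal m x (int (i * K), int j) (L i j)" if "i < w" "j < h" for i j
  proof -
    have "x (int (i * K) + int (i' * K + 3), int j) \<longleftrightarrow> i' < m" if "i' \<le> m" "i = 0" "j = 0" for i'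
    proof -
      have "i' < w" "0 < h" "inp (L i' 0) \<longleftrightarrow> i' < m" using assms(1) that by (auto simp: tiling_def)
      moreover have "3 < K" by (simp add: K_def)
      ultimately have "x (int (i' * K) + int 3, int 0) \<longleftrightarrow> i' < m"
        using reads[of i' 0] word_simps(3)[of "L i' 0"] by (auto simp: reads_def)
      then show ?thesis using that by simp
    qed
    moreover have "lft (L i j) \<longleftrightarrow> i = 0" "lwr (L i j) \<longleftrightarrow> j = 0"
      using assms(1) that by (auto simp: tiling_def)
    ultimately show ?thesis using good[OF that] by (auto simp: legal_def)
  qed
  have "ca m x (a, b) = x (a, b)" if "(a, b) \<in> D" for a b
  proof -
    define i e j where "i = nat a div K" and "e = nat a mod K" and "j = nat b"
    have "0 < K" by (simp add: K_def)
    have ab: "0 \<le> a" "a < int (w * K)" "b = int j" "j < h" using that by (auto simp: D j_def)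
    then have "nat a < w * K" by linarith
    then have "i < w" by (simp add: i_def less_mult_imp_div_less)
    moreover have "a = int (i * K) + int e" using ab(1)
      by (simp add: i_def e_def flip: of_nat_add of_nat_mult)
    moreover have "e < K" using \<open>0 < K\<close> by (simp add: e_def)
    ultimately have "\<exists>e<K. \<exists>c. legal m x (a - int e, b) c" using legal[of i j] ab by (intro exI[of _ e]) auto
    then show ?thesis by (auto simp: ca_iff)
  qed
  then show ?thesis using x by (auto simp: cylinder_def)
qed

end

section \<open>Freezing automata on Bernoulli configurations\<close>

text \<open>Makes the configuration space second countable.\<close>

instance bool :: second_countable_topology
proof
  have "open = generate_topology (UNIV :: bool set set)"
    by (auto intro!: ext generate_topology.Basis Topological_Spaces.open_discrete)
  then show "\<exists>B :: bool set set. countable B \<and> open = generate_topology B" by blast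
qed

lemma open_cylinder: "finite D \<Longrightarrow> open (cylinder D u)"
proof -
  assume "finite D"
  have "open ((\<lambda>x. x v) -` {u v})" for v :: cell
    using Topological_Spaces.open_discrete[of "{u v}"] by (rule open_vimage) (rule continuous_on_product_coordinates)
  then have "open (\<Inter>v\<in>D. (\<lambda>x. x v) -` {u v})" using \<open>finite D\<close> by (intro open_INT) auto
  also have "(\<Inter>v\<in>D. (\<lambda>x. x v) -` {u v}) = cylinder D u" by (auto simp: cylinder_def)
  finally show ?thesis .
qed

lemma cylinder_in_borel [measurable]: "finite D \<Longrightarrow> cylinder D u \<in> sets borel"
  by (intro borel_open open_cylinder)

lemma pred_borel:
  assumes "{x. P x} \<in> sets borel" shows "P \<in> borel \<rightarrow>\<^sub>M (borel :: bool measure)"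
proof -
  have "P \<in> borel \<rightarrow>\<^sub>M count_space UNIV" using assms by (simp add: pred_def)
  then show ?thesis
    using measurable_cong_sets[OF refl sets_borel_eq_count_space[where 'a = bool]] by blast
qed

lemma sets_cell [measurable]: "{x :: config. x v} \<in> sets borel"
  using cylinder_in_borel[of "{v}" "\<lambda>_. True"] by (simp add: cylinder_def)

lemma sets_bernoulli [measurable_cong]: "sets (bernoulli p) = sets borel"
proof -
  have "sets (bernoulli p) = sets (Pi\<^sub>M UNIV (\<lambda>_ :: cell. borel :: bool measure))"
    unfolding bernoulli_def by (intro sets_PiM_cong) (auto simp: sets_borel_eq_count_space)
  then show ?thesis by (simp add: sets_PiM_equal_borel)
qed

lemma space_bernoulli [simp]: "space (bernoulli p) = UNIV"
  by (simp add: bernoulli_def space_PiM)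

lemma prob_space_bernoulli: "prob_space (bernoulli p)"
  unfolding bernoulli_def by (intro prob_space_PiM prob_space_measure_pmf)

lemma measure_bernoulli_cylinder:
  assumes "0 \<le> p" "p \<le> 1" "finite D"
  shows "measure (bernoulli p) (cylinder D u) = (\<Prod>v\<in>D. if u v then p else 1 - p)"
proof -
  interpret product_prob_space "\<lambda>_ :: cell. measure_pmf (bernoulli_pmf p)" UNIV
    by (intro product_prob_spaceI prob_space_measure_pmf)
  have "cylinder D u = prod_emb UNIV (\<lambda>_. measure_pmf (bernoulli_pmf p)) D (Pi\<^sub>E D (\<lambda>v. {u v}))"
    by (auto simp: cylinder_def prod_emb_def restrict_def PiE_def extensional_def Pi_iff)
  then have "measure (bernoulli p) (cylinder D u) = (\<Prod>v\<in>D. measure (measure_pmf (bernoulli_pmf p)) {u v})"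
    unfolding bernoulli_def using assms(3) by (simp add: measure_PiM_emb)
  also have "\<dots> = (\<Prod>v\<in>D. if u v then p else 1 - p)"
    using assms(1,2) by (intro prod.cong) (auto simp: measure_pmf_single)
  finally show ?thesis .
qed

text \<open>The first \<open>n\<close> cells of the sequence are all 0 with probability \<open>(1 - p) ^ n\<close>.\<close>

lemma AE_one_in_sequence:
  assumes p: "0 < p" "p < 1" and c: "inj (c :: nat \<Rightarrow> cell)"
  shows "AE x in bernoulli p. \<exists>i. x (c i)"
proof -
  interpret prob_space "bernoulli p" by (rule prob_space_bernoulli)
  let ?E = "{x. \<forall>i. \<not> x (c i)}"
  have "?E = (\<Inter>i. - {x. x (c i)})" by auto
  also have "\<dots> \<in> sets borel" using sets_cell by (intro sets.countable_INT'') auto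
  finally have [measurable]: "?E \<in> events" by (simp add: sets_bernoulli)
  have le: "prob ?E \<le> (1 - p) ^ n" for n
  proof -
    have "prob ?E \<le> prob (cylinder (c ` {..<n}) (\<lambda>_. False))"
      by (rule finite_measure_mono) (force simp: cylinder_def, simp add: sets_bernoulli cylinder_in_borel)
    also have "\<dots> = (1 - p) ^ n"
      using p c by (simp add: measure_bernoulli_cylinder card_image inj_on_subset)
    finally show ?thesis .
  qed
  have "(\<lambda>n. (1 - p) ^ n) \<longlonglongrightarrow> 0" using p by (intro LIMSEQ_realpow_zero) auto
  then have "prob ?E \<le> 0" using le by (intro LIMSEQ_le_const) auto
  then have "prob ?E = 0" by (simp add: measure_le_0_iff)
  then have "AE x in bernoulli p. x \<notin> ?E" by (subst (asm) prob_eq_0) auto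
  then show ?thesis by simp
qed

text \<open>By Lindelof's theorem the complement of the support is a countable union of open null sets.\<close>

lemma supp_meets_open:
  assumes "prob_space \<nu>" and sets: "sets \<nu> = sets borel" and "open U" "0 < measure \<nu> U"
  shows "supp \<nu> \<inter> U \<noteq> {}"
proof
  interpret prob_space \<nu> by fact
  note [measurable_cong] = sets
  have space: "space \<nu> = UNIV" using sets_eq_imp_space_eq[OF sets] by simp
  assume "supp \<nu> \<inter> U = {}"
  let ?G = "uminus ` {C. closed C \<and> measure \<nu> C = 1}"
  obtain G where G: "G \<subseteq> ?G" "countable G" "\<Union>G = \<Union>?G"
    by (rule Lindelof[of ?G]) auto
  have "U \<subseteq> \<Union>?G" using \<open>supp \<nu> \<inter> U = {}\<close> unfolding supp_def by blast
  have "AE x in \<nu>. x \<notin> X" if X: "X \<in> G" for X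
  proof -
    obtain C where C: "X = - C" "closed C" "measure \<nu> C = 1" using X G(1) by blast
    then have "C \<in> events" by (simp add: sets borel_closed)
    then have "AE x in \<nu>. x \<in> C" using C(3) by (simp add: prob_eq_1)
    then show ?thesis by (simp add: C(1))
  qed
  then have "AE x in \<nu>. \<forall>X\<in>G. x \<notin> X" using G(2) by (simp add: AE_ball_countable)
  then have "AE x in \<nu>. x \<notin> U" using \<open>U \<subseteq> \<Union>?G\<close> G(3) by (auto elim!: eventually_mono)
  moreover have "U \<in> events" using \<open>open U\<close> by (simp add: sets borel_open)
  ultimately have "measure \<nu> U = 0" by (simp add: prob_eq_0)
  then show False using assms(4) by simp
qed

locale freezing_ca =
  fixes N :: "cell set" and F :: "config \<Rightarrow> bool"
  assumes finite_N: "finite N" and freezing: "freezing (ca_map N F)"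
begin

abbreviation step :: "config \<Rightarrow> config" where "step \<equiv> ca_map N F"

definition limit :: "config \<Rightarrow> config" where
  "limit x = (\<lambda>v. \<exists>n. (step ^^ n) x v)"

lemma step_mono: assumes "x v" shows "step x v"
proof -
  have "x \<le> step x" using freezing by (simp add: freezing_def)
  then show ?thesis using assms by (auto dest: le_funD[of _ _ v])
qed

lemma step_cong: "(\<And>n. n \<in> N \<Longrightarrow> x (v + n) = y (v + n)) \<Longrightarrow> step x v = step y v"
  unfolding ca_map_def by (rule arg_cong[where f = F]) (auto simp: restrict_def)

lemma iterate_mono: "(step ^^ n) x v \<Longrightarrow> n \<le> k \<Longrightarrow> (step ^^ k) x v"
  by (induction k) (auto simp: le_Suc_eq step_mono)

lemma eventually_limit:
  assumes "finite D" shows "eventually (\<lambda>n. \<forall>v\<in>D. (step ^^ n) x v = limit x v) sequentially"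
proof -
  have "eventually (\<lambda>n. (step ^^ n) x v = limit x v) sequentially" for v
  proof (cases "limit x v")
    case True
    then obtain n where "(step ^^ n) x v" by (auto simp: limit_def)
    then show ?thesis using True iterate_mono unfolding eventually_sequentially by blast
  next
    case False
    then show ?thesis by (intro always_eventually) (auto simp: limit_def)
  qed
  then show ?thesis using assms by (simp add: eventually_ball_finite)
qed

lemma limit_fixed: "step (limit x) = limit x"
proof
  fix v
  show "step (limit x) v = limit x v"
  proof (cases "limit x v")
    case False
    have "finite ((+) v ` N)" using finite_N by simp
    from eventually_limit[OF this, of x] obtain n where n: "\<And>w. w \<in> N \<Longrightarrow> (step ^^ n) x (v + w) = limit x (v + w)"
      unfolding eventually_sequentially by blast
    have "step (limit x) v = step ((step ^^ n) x) v"
      by (rule step_cong) (simp add: n)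
    also have "\<dots> = (step ^^ Suc n) x v" by simp
    also have "\<dots> = False" using False unfolding limit_def by blast
    finally show ?thesis using False by simp
  qed (simp add: step_mono)
qed

lemma measurable_step [measurable]: "step \<in> borel \<rightarrow>\<^sub>M borel"
proof -
  have "(\<lambda>x. step x v) \<in> borel_measurable borel" for v
  proof -
  have "{x. step x v} = (\<Union>P\<in>{P. P \<subseteq> N \<and> F (\<lambda>n\<in>N. n \<in> P)}. cylinder ((+) v ` N) (\<lambda>w. w - v \<in> P))"
    (is "_ = ?U")
  proof (intro equalityI subsetI)
    fix x assume "x \<in> {x. step x v}"
    moreover have "(\<lambda>n\<in>N. n \<in> {n \<in> N. x (v + n)}) = (\<lambda>n\<in>N. x (v + n))" by (auto simp: restrict_def)
    ultimately show "x \<in> ?U"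
      by (intro UN_I[of "{n \<in> N. x (v + n)}"]) (auto simp: ca_map_def cylinder_def)
  next
    fix x assume "x \<in> ?U"
    then obtain P where P: "F (\<lambda>n\<in>N. n \<in> P)" "x \<in> cylinder ((+) v ` N) (\<lambda>w. w - v \<in> P)" by blast
    then have "(\<lambda>n\<in>N. x (v + n)) = (\<lambda>n\<in>N. n \<in> P)" by (auto simp: cylinder_def restrict_def)
    then show "x \<in> {x. step x v}" using P(1) by (simp add: ca_map_def)
  qed
  moreover have "?U \<in> sets borel"
    using finite_N by (intro sets.finite_UN cylinder_in_borel finite_imageI) auto
  ultimately have "{x. step x v} \<in> sets borel" by simp
  then show "(\<lambda>x. step x v) \<in> borel_measurable borel"
    by (rule pred_borel)
  qed
  then show ?thesis by (rule measurable_coordinatewise_then_product)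
qed

lemma measurable_iterate [measurable]: "step ^^ n \<in> borel \<rightarrow>\<^sub>M borel"
  by (induction n) (auto intro: measurable_comp[unfolded comp_def] simp: comp_def id_def)

lemma measurable_limit [measurable]: "limit \<in> borel \<rightarrow>\<^sub>M borel"
proof -
  have "(\<lambda>x. limit x v) \<in> borel \<rightarrow>\<^sub>M borel" for v
  proof (rule pred_borel)
    have "(step ^^ n) -` {x. x v} \<in> sets borel" for n
      using measurable_sets[OF measurable_iterate sets_cell] by simp
    then have "(\<Union>n. (step ^^ n) -` {x. x v}) \<in> sets borel" by blast
    also have "(\<Union>n. (step ^^ n) -` {x. x v}) = {x. limit x v}" by (auto simp: limit_def)
    finally show "{x. limit x v} \<in> sets borel" .
  qed
  then show ?thesis by (rule measurable_coordinatewise_then_product)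
qed

text \<open>On a finite set of cells the orbit is eventually equal to its limit; dominated convergence turns this into
convergence of the measures of cylinders.\<close>

lemma iterate_cylinder_tendsto:
  assumes D: "finite D"
  shows "(\<lambda>n. measure (distr (bernoulli p) borel (step ^^ n)) (cylinder D u))
     \<longlonglongrightarrow> measure (distr (bernoulli p) borel limit) (cylinder D u)"
proof -
  interpret prob_space "bernoulli p" by (rule prob_space_bernoulli)
  have [measurable]: "step ^^ n \<in> bernoulli p \<rightarrow>\<^sub>M borel" "limit \<in> bernoulli p \<rightarrow>\<^sub>M borel" for n
    using measurable_iterate measurable_limit by measurable
  let ?A = "\<lambda>n. {x. (step ^^ n) x \<in> cylinder D u}" and ?B = "{x. limit x \<in> cylinder D u}"
  have [measurable]: "?A n \<in> events" "?B \<in> events" for n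
    using D by measurable
  have "(\<lambda>n. integral\<^sup>L (bernoulli p) (indicator (?A n) :: _ \<Rightarrow> real))
      \<longlonglongrightarrow> integral\<^sup>L (bernoulli p) (indicator ?B)"
  proof (rule integral_dominated_convergence[where w = "\<lambda>_. 1"])
    show "AE x in bernoulli p. (\<lambda>n. indicator (?A n) x :: real) \<longlonglongrightarrow> indicator ?B x"
    proof (rule AE_I2)
      fix x
      have "eventually (\<lambda>n. (indicator (?A n) x :: real) = indicator ?B x) sequentially"
        using eventually_limit[OF D, of x]
        by eventually_elim (auto simp: indicator_def cylinder_def)
      then show "(\<lambda>n. indicator (?A n) x :: real) \<longlonglongrightarrow> indicator ?B x" by (rule tendsto_eventually)
    qed
  qed auto
  moreover have "measure (distr (bernoulli p) borel g) (cylinder D u) = prob {x. g x \<in> cylinder D u}"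
    if "g \<in> bernoulli p \<rightarrow>\<^sub>M borel" for g
    using that D by (subst measure_distr) (auto simp: vimage_def)
  ultimately show ?thesis by simp
qed

lemma distr_limit_in_limit_measures:
  "distr (bernoulli p) borel limit \<in> limit_measures (\<lambda>n. distr (bernoulli p) borel (step ^^ n))"
proof -
  interpret prob_space "bernoulli p" by (rule prob_space_bernoulli)
  have "limit \<in> bernoulli p \<rightarrow>\<^sub>M borel" using measurable_limit by measurable
  then have prob: "prob_space (distr (bernoulli p) borel limit)" by (rule prob_space_distr)
  have id: "strict_mono (\<lambda>n :: nat. n)" by (simp add: strict_mono_def)
  have "weak_conv_config ((\<lambda>n. distr (bernoulli p) borel (step ^^ n)) \<circ> (\<lambda>n. n))
      (distr (bernoulli p) borel limit)"
    unfolding weak_conv_config_def comp_def using iterate_cylinder_tendsto by blast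
  then show ?thesis unfolding limit_measures_def
    by (intro CollectI conjI prob sets_distr exI[of _ "\<lambda>n. n"] id)
qed

text \<open>Every limit point of the sequence of measures gives full measure to each cylinder on which a single cell is 1, hence is
the point mass at the configuration of ones.\<close>

lemma trivializes_if_AE_ones:
  assumes AE: "AE x in bernoulli p. limit x = (\<lambda>_. True)"
  shows "trivializes step (bernoulli p)"
proof -
  interpret prob_space "bernoulli p" by (rule prob_space_bernoulli)
  have m: "limit \<in> bernoulli p \<rightarrow>\<^sub>M borel" using measurable_limit by measurable
  let ?one = "(\<lambda>_. True) :: config" and ?M = "\<lambda>n. distr (bernoulli p) borel (step ^^ n)"
  have lim1: "measure (distr (bernoulli p) borel limit) (cylinder D u) = (if \<forall>v\<in>D. u v then 1 else 0)"
    if "finite D" for D u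
  proof -
    have "measure (distr (bernoulli p) borel limit) (cylinder D u) = prob {x. limit x \<in> cylinder D u}"
      using that m by (subst measure_distr) (auto simp: vimage_def)
    moreover have ev: "{x. limit x \<in> cylinder D u} \<in> events" using that m by measurable
    moreover have "AE x in bernoulli p. x \<in> {x. limit x \<in> cylinder D u} \<longleftrightarrow> (\<forall>v\<in>D. u v)"
      using AE by eventually_elim (simp add: cylinder_def)
    then have "prob {x. limit x \<in> cylinder D u} = (if \<forall>v\<in>D. u v then 1 else 0)"
      using prob_eq_1[OF ev] prob_eq_0[OF ev] by (cases "\<forall>v\<in>D. u v") simp_all
    ultimately show ?thesis by simp
  qed
  have "closed (cylinder {v} ?one)" for v
  proof -
    have "- cylinder {v} ?one = cylinder {v} (\<lambda>_. False)" by (auto simp: cylinder_def)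
    then show ?thesis using open_cylinder[of "{v}" "\<lambda>_. False"] by (simp add: closed_def)
  qed
  then have "closed (\<Inter>v. cylinder {v} ?one)" by (intro closed_INT) simp
  also have "(\<Inter>v. cylinder {v} ?one) = {?one}" by (auto simp: cylinder_def)
  finally have "closed {?one}" .
  have supp1: "supp \<nu> = {?one}" if "\<nu> \<in> limit_measures ?M" for \<nu>
  proof -
    from that obtain r where \<nu>: "prob_space \<nu>" "sets \<nu> = sets borel" and r: "strict_mono r" "weak_conv_config (?M \<circ> r) \<nu>"
      by (auto simp: limit_measures_def)
    interpret nu: prob_space \<nu> by fact
    note [measurable_cong] = \<nu>(2)
    have "measure \<nu> (cylinder {v} ?one) = 1" for v
    proof -
      have "(\<lambda>n. measure ((?M \<circ> r) n) (cylinder {v} ?one)) \<longlonglongrightarrow> measure \<nu> (cylinder {v} ?one)"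
        using r(2) by (simp add: weak_conv_config_def)
      moreover have "(\<lambda>n. measure ((?M \<circ> r) n) (cylinder {v} ?one)) \<longlonglongrightarrow> 1"
        using LIMSEQ_subseq_LIMSEQ[OF iterate_cylinder_tendsto[of "{v}" p ?one] r(1)] lim1[of "{v}" ?one]
        by (simp add: comp_def)
      ultimately show ?thesis by (rule LIMSEQ_unique)
    qed
    moreover have "cylinder {v} ?one \<in> nu.events" for v by (simp add: \<nu>(2) cylinder_in_borel)
    ultimately have "AE x in \<nu>. x \<in> cylinder {v} ?one" for v by (simp add: nu.prob_eq_1)
    then have "AE x in \<nu>. \<forall>v. x \<in> cylinder {v} ?one" by (simp add: AE_all_countable)
    then have one: "AE x in \<nu>. x \<in> {?one}" by (auto simp: cylinder_def elim!: eventually_mono)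
    have "measure \<nu> {?one} = 1"
      using one borel_closed[OF \<open>closed {?one}\<close>] by (subst nu.prob_eq_1) (simp_all add: \<nu>(2))
    moreover have "?one \<in> C" if "closed C" "measure \<nu> C = 1" for C
    proof -
      have "C \<in> nu.events" using that by (simp add: \<nu>(2) borel_closed)
      then have "AE x in \<nu>. x \<in> C" using that by (simp add: nu.prob_eq_1)
      with one have "AE x in \<nu>. x \<in> C \<and> x = ?one" by eventually_elim simp
      then obtain x where "x \<in> C \<and> x = ?one"
        by (metis (no_types, lifting) eventually_happens' nu.ae_filter_bot)
      then show ?thesis by blast
    qed
    ultimately show ?thesis unfolding supp_def using \<open>closed {?one}\<close> by blast
  qed
  have "distr (bernoulli p) borel limit \<in> limit_measures ?M"
    by (rule distr_limit_in_limit_measures)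
  then have "mu_limit_set (bernoulli p) step = {?one}"
    unfolding mu_limit_set_def using supp1 closure_closed[OF \<open>closed {?one}\<close>] by auto
  then show ?thesis by (simp add: trivializes_def)
qed

text \<open>Under the limit measure the cell \<open>v\<close> is 0 with positive probability, because the pattern occurs with positive
probability, and 1 with probability at least \<open>p\<close>. The support meets both of these open sets.\<close>

lemma not_trivializes_if_stable_pattern:
  assumes p: "0 < p" "p < 1" and D: "finite D" 
    and stable: "\<And>x. x \<in> cylinder D u \<Longrightarrow> step x \<in> cylinder D u"
    and v: "v \<in> D" "\<not> u v"
  shows "\<not> trivializes step (bernoulli p)"
proof
  interpret prob_space "bernoulli p" by (rule prob_space_bernoulli)
  have m[measurable]: "limit \<in> bernoulli p \<rightarrow>\<^sub>M borel" using measurable_limit by measurable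
  let ?M = "\<lambda>n. distr (bernoulli p) borel (step ^^ n)" and ?\<nu> = "distr (bernoulli p) borel limit"
  assume "trivializes step (bernoulli p)"
  then obtain y where y: "mu_limit_set (bernoulli p) step = {y}"
    by (auto simp: trivializes_def card_1_singleton_iff)
  have "?\<nu> \<in> limit_measures ?M"
    by (rule distr_limit_in_limit_measures)
  then have "supp ?\<nu> \<subseteq> (\<Union>\<nu>\<in>limit_measures ?M. supp \<nu>)" by (rule UN_upper)
  also have "\<dots> \<subseteq> {y}" unfolding y[symmetric] mu_limit_set_def by (rule closure_subset)
  finally have "supp ?\<nu> \<subseteq> {y}" .
  moreover have "supp ?\<nu> \<inter> cylinder {v} w \<noteq> {}"
    if "finite E" "\<And>x. x \<in> cylinder E u' \<Longrightarrow> limit x v = w v" for E u' w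
  proof (rule supp_meets_open)
    have "0 < prob (cylinder E u')" using p \<open>finite E\<close> by (simp add: measure_bernoulli_cylinder prod_pos)
    also have "\<dots> \<le> prob (limit -` cylinder {v} w \<inter> space (bernoulli p))"
    proof (rule finite_measure_mono)
      show "cylinder E u' \<subseteq> limit -` cylinder {v} w \<inter> space (bernoulli p)"
        using that(2) by (auto simp: cylinder_def[of "{v}"])
      show "limit -` cylinder {v} w \<inter> space (bernoulli p) \<in> events"
        by (rule measurable_sets[OF m]) (simp add: cylinder_in_borel)
    qed
    also have "\<dots> = measure ?\<nu> (cylinder {v} w)"
      by (subst measure_distr) auto
    finally show "0 < measure ?\<nu> (cylinder {v} w)" .
  qed (auto intro: prob_space_distr open_cylinder)
  note meets = this
  have "limit x v" if "x \<in> cylinder {v} (\<lambda>_. True)" for x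
    using that unfolding limit_def by (intro exI[of _ 0]) (simp add: cylinder_def)
  then have "supp ?\<nu> \<inter> cylinder {v} (\<lambda>_. True) \<noteq> {}" by (intro meets[of "{v}" "\<lambda>_. True"]) simp_all
  moreover have "\<not> limit x v" if "x \<in> cylinder D u" for x
  proof -
    have "(step ^^ n) x \<in> cylinder D u" for n by (induction n) (use that stable in auto)
    then have "(step ^^ n) x v = u v" for n using v(1) by (simp add: cylinder_def)
    then show ?thesis using v(2) by (simp add: limit_def)
  qed
  then have "supp ?\<nu> \<inter> cylinder {v} (\<lambda>_. False) \<noteq> {}" by (intro meets[of D u] D) simp_all
  ultimately have "y \<in> cylinder {v} (\<lambda>_. True)" "y \<in> cylinder {v} (\<lambda>_. False)" by blast+
  then show False by (simp add: cylinder_def)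
qed

end

section \<open>Diagonalization\<close>

lemma freezing_ca_tile_rule: "freezing_ca (nbhd k m) (tile_rule k s m)"
proof
  have "(0, 0) \<in> nbhd k m" by (rule in_nbhd) simp_all
  then have "ca_map (nbhd k m) (tile_rule k s m) x v" if "x v" for x v
    using that by (cases v) (simp add: ca_map_def tile_rule_def)
  then show "freezing (ca_map (nbhd k m) (tile_rule k s m))"
    by (auto simp: freezing_def intro!: le_funI)
qed (rule finite_nbhd)

context tile_system
begin

text \<open>The density \<open>p\<close> matters neither for the occurrence of a finite pattern with positive probability nor for the
occurrence of 1 in a sequence of cells.\<close>

theorem trivializes_ca_iff:
  assumes p: "0 < p" "p < 1"
  shows "trivializes (ca m) (bernoulli p) \<longleftrightarrow> \<not> (\<exists>w h L. tiling m w h L)"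
proof -
  interpret freezing_ca "nbhd K m" "tile_rule K S m" by (rule freezing_ca_tile_rule)
  show ?thesis
  proof
    assume "trivializes (ca m) (bernoulli p)"
    moreover have "\<not> trivializes (ca m) (bernoulli p)" if T: "tiling m w h L" for w h L
    proof -
      have "0 < w" "0 < h" using T by (auto simp: tiling_def)
      then have "(0, 0) \<in> {0..<int (w * K)} \<times> {0..<int h}" by (simp add: K_def)
      moreover have fin: "finite ({0..<int (w * K)} \<times> {0..<int h})" by simp
      moreover have "\<not> picture L (0, 0)" by (simp add: picture_def word_simps)
      ultimately show ?thesis unfolding ca_def
        using not_trivializes_if_stable_pattern[OF p fin tiling_stable[OF T refl, unfolded ca_def]]
        by blast
    qed
    ultimately show "\<not> (\<exists>w h L. tiling m w h L)" by blast
  next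
    assume no: "\<not> (\<exists>w h L. tiling m w h L)"
    have "AE x in bernoulli p. d \<noteq> 0 \<longrightarrow> (\<exists>i. x (fst v + int i * fst d, snd v + int i * snd d))"
      for v d :: cell
    proof (cases "d = 0")
      case False
      then have "inj (\<lambda>i :: nat. (fst v + int i * fst d, snd v + int i * snd d))"
        by (auto simp: inj_def prod_eq_iff)
      from AE_one_in_sequence[OF p this] show ?thesis by eventually_elim blast
    qed simp
    then have "AE x in bernoulli p. \<forall>v d. d \<noteq> 0 \<longrightarrow> (\<exists>i. x (fst v + int i * fst d, snd v + int i * snd d))"
      unfolding AE_all_countable by blast
    then have "AE x in bernoulli p. limit x = (\<lambda>_. True)"
    proof eventually_elim
      fix x
      assume x: "\<forall>v d. d \<noteq> 0 \<longrightarrow> (\<exists>i. x (fst v + int i * fst d, snd v + int i * snd d))"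
      have "x v \<Longrightarrow> limit x v" for v unfolding limit_def by (rule exI[of _ 0]) simp
      then have ones: "\<exists>i :: nat. limit x (fst v + int i * fst d, snd v + int i * snd d)" if "d \<noteq> 0" for v d
        using x that by meson
      have "limit x v" for v
      proof (rule ccontr)
        assume "\<not> limit x v"
        from tiling_of_fixed_point[OF limit_fixed[folded ca_def] this ones] show False using no by simp
      qed
      then show "limit x = (\<lambda>_. True)" by (simp add: fun_eq_iff)
    qed
    then show "trivializes (ca m) (bernoulli p)" unfolding ca_def by (rule trivializes_if_AE_ones)
  qed
qed

end

lemma finite_instr_regs: "finite (instr_regs i)"
  by (cases i) auto

lemma counter_machine_of_program:
  "\<exists>Q B. counter_machine ctrl_step Q q\<^sub>0 B"
proof -
  let ?Q = "conts q\<^sub>0 []"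
  define R where "R = insert 1 (\<Union>q\<in>?Q. instr_regs (ctrl_step q))"
  have "finite R" unfolding R_def by (intro finite.insertI finite_UN_I finite_conts finite_instr_regs)
  then obtain B where B: "\<forall>i\<in>R. i < B" unfolding finite_nat_set_iff_bounded by (elim exE)
  have "counter_machine ctrl_step ?Q q\<^sub>0 B"
  proof
    fix q assume q: "q \<in> ?Q"
    show "targets (ctrl_step q) \<subseteq> ?Q" using conts_closed[OF q] by (cases "q = []") auto
    show "instr_regs (ctrl_step q) \<subseteq> {..<B}"
    proof
      fix i assume "i \<in> instr_regs (ctrl_step q)"
      then have "i \<in> R" using q unfolding R_def by blast
      then show "i \<in> {..<B}" using B by simp
    qed
  next
    show "q\<^sub>0 \<in> ?Q" using conts_start[of q\<^sub>0 "[]"] by simp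
    show "1 < B" using B by (simp add: R_def)
  qed (rule finite_conts)
  then show ?thesis by blast
qed

text \<open>Registers 0 and 1 of the compiled program are the counters that the tiles single out for acceptance and input. The
machine accepts if the output is positive.\<close>

theorem trivializes_iff_output_0:
  "\<exists>k s. \<forall>m v p. eval R [m] v \<longrightarrow> 0 < p \<longrightarrow> p < 1 \<longrightarrow>
     (trivializes (ca_map (nbhd k m) (tile_rule k s m)) (bernoulli p) \<longleftrightarrow> v = 0)"
proof -
  define q\<^sub>0 where "q\<^sub>0 = compile R [1] 0 2"
  obtain Q B where "counter_machine ctrl_step Q q\<^sub>0 B" using counter_machine_of_program by blast
  then interpret counter_machine ctrl_step Q q\<^sub>0 B .
  have "trivializes (ca m) (bernoulli p) \<longleftrightarrow> v = 0" if "eval R [m] v" "0 < p" "p < 1" for m v p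
  proof -
    have "computes q\<^sub>0 0 2 ((\<lambda>_. 0)(1 := m)) v"
      unfolding q\<^sub>0_def by (rule compile_correct[OF that(1)]) auto
    then obtain t where "exec q\<^sub>0 ((\<lambda>_. 0)(1 := m)) t" and t: "t 0 = v" unfolding computes_def by blast
    then have run: "((q\<^sub>0, (\<lambda>_. 0)(1 := m)), ([], t)) \<in> (cm_rel ctrl_step)\<^sup>*"
      unfolding exec_def by (metis append_Nil2)
    have tiling: "(\<exists>w h L. tiling m w h L) \<longleftrightarrow> 0 < v"
    proof
      assume "\<exists>w h L. tiling m w h L"
      then obtain q t' where q: "((q\<^sub>0, (\<lambda>_. 0)(1 := m)), (q, t')) \<in> (cm_rel ctrl_step)\<^sup>*"
        "ctrl_step q = Stop" "0 < t' 0" unfolding tiling_iff_halts by blast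
      then have "t' = t" using cm_halt_unique[OF q(1) run] by simp
      then show "0 < v" using q(3) t by simp
    next
      assume "0 < v"
      then show "\<exists>w h L. tiling m w h L" unfolding tiling_iff_halts
        using run t by (intro exI[of _ "[]"] exI[of _ t]) simp
    qed
    show ?thesis unfolding trivializes_ca_iff[OF that(2,3)] tiling by simp
  qed
  then show ?thesis unfolding ca_def by blast
qed

text \<open>The diagonal argument applies to every property \<open>Q\<close> that agrees with trivialization whenever the latter does not
depend on the density.\<close>

theorem undecidable_trivialization:
  assumes Q: "\<And>N F. (\<And>p. 0 < p \<Longrightarrow> p < 1 \<Longrightarrow> trivializes (ca_map N F) (bernoulli p)) \<Longrightarrow> Q N F"
    and Q': "\<And>N F. (\<And>p. 0 < p \<Longrightarrow> p < 1 \<Longrightarrow> \<not> trivializes (ca_map N F) (bernoulli p)) \<Longrightarrow> \<not> Q N F"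
  shows "\<not> decidable_given ca_code (\<lambda>(N, F). finite N \<and> freezing (ca_map N F)) (\<lambda>(N, F). Q N F)"
proof
  assume "decidable_given ca_code (\<lambda>(N, F). finite N \<and> freezing (ca_map N F)) (\<lambda>(N, F). Q N F)"
  then obtain r where "\<forall>i. (case i of (N, F) \<Rightarrow> finite N \<and> freezing (ca_map N F)) \<longrightarrow>
      eval r [ca_code i] (if (case i of (N, F) \<Rightarrow> Q N F) then 1 else 0)"
    unfolding decidable_given_def by (erule exE)
  then have r: "eval r [ca_code (N, F)] (if Q N F then 1 else 0)"
    if "finite N" "freezing (ca_map N F)" for N F
    using that by (auto dest: spec[of _ "(N, F)"])
  obtain g where g: "\<And>k s. eval g [prod_encode (k, s)]
      (ca_code (nbhd k (prod_encode (k, s)), tile_rule k s (prod_encode (k, s))))"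
  proof -
    obtain g where "\<forall>xs. length xs = 1 \<longrightarrow> eval g xs (let m = xs ! 0; k = fst (prod_decode m);
        s = snd (prod_decode m) in ca_code (nbhd k m, tile_rule k s m))"
      using total_rec_ca_code unfolding total_rec_def by blast
    then have "eval g [prod_encode (k, s)]
      (ca_code (nbhd k (prod_encode (k, s)), tile_rule k s (prod_encode (k, s))))" for k s
      by (elim allE[of _ "[prod_encode (k, s)]"]) (simp add: Let_def)
    then show ?thesis by (rule that)
  qed
  obtain k s where ks: "\<forall>m v p. eval (Comp r [g]) [m] v \<longrightarrow> 0 < p \<longrightarrow> p < 1 \<longrightarrow>
     (trivializes (ca_map (nbhd k m) (tile_rule k s m)) (bernoulli p) \<longleftrightarrow> v = 0)"
    using trivializes_iff_output_0[of "Comp r [g]"] by (elim exE) blast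
  define m where "m = prod_encode (k, s)"
  define v where "v = (if Q (nbhd k m) (tile_rule k s m) then 1 else 0 :: nat)"
  interpret freezing_ca "nbhd k m" "tile_rule k s m" by (rule freezing_ca_tile_rule)
  have "eval r [ca_code (nbhd k m, tile_rule k s m)] v"
    unfolding v_def by (rule r[OF finite_N freezing])
  moreover have "list_all2 (\<lambda>g y. eval g [m] y) [g] [ca_code (nbhd k m, tile_rule k s m)]"
    using g[of k s] by (simp add: m_def)
  ultimately have "eval (Comp r [g]) [m] v" by (intro comp)
  then have triv: "trivializes (ca_map (nbhd k m) (tile_rule k s m)) (bernoulli p) \<longleftrightarrow> v = 0"
    if "0 < p" "p < 1" for p
    using ks that by simp
  show False
  proof (cases "v = 0")
    case True
    then have "Q (nbhd k m) (tile_rule k s m)" using triv by (intro Q) simp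
    then show False using True by (simp add: v_def)
  next
    case False
    then have "\<not> Q (nbhd k m) (tile_rule k s m)" using triv by (intro Q') simp
    then show False using False by (simp add: v_def)
  qed
qed

theorem theorem4p2:
  "\<not> decidable_given ca_code
       (\<lambda>(N, F). finite N \<and> freezing (ca_map N F))
       (\<lambda>(N, F). \<exists>p. 0 < p \<and> p < 1 \<and> trivializes (ca_map N F) (bernoulli p)) \<and>
   \<not> decidable_given ca_code
       (\<lambda>(N, F). finite N \<and> freezing (ca_map N F))
       (\<lambda>(N, F). \<forall>p. 0 < p \<and> p < 1 \<longrightarrow> trivializes (ca_map N F) (bernoulli p))"
proof (rule conjI; rule undecidable_trivialization)
  fix N and F :: "config \<Rightarrow> bool"
  have half: "(0::real) < 1 / 2" "1 / 2 < (1::real)" by simp_all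
  let ?triv = "\<lambda>p. trivializes (ca_map N F) (bernoulli p)"
  show "\<exists>p. 0 < p \<and> p < 1 \<and> ?triv p" if "\<And>p. 0 < p \<Longrightarrow> p < 1 \<Longrightarrow> ?triv p"
    using half that[OF half] by (intro exI[of _ "1 / 2"] conjI)
  show "\<not> (\<exists>p. 0 < p \<and> p < 1 \<and> ?triv p)" if "\<And>p. 0 < p \<Longrightarrow> p < 1 \<Longrightarrow> \<not> ?triv p"
    using that by simp
  show "\<forall>p. 0 < p \<and> p < 1 \<longrightarrow> ?triv p" if "\<And>p. 0 < p \<Longrightarrow> p < 1 \<Longrightarrow> ?triv p"
    using that by simp
  show "\<not> (\<forall>p. 0 < p \<and> p < 1 \<longrightarrow> ?triv p)" if "\<And>p. 0 < p \<Longrightarrow> p < 1 \<Longrightarrow> \<not> ?triv p"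
  proof
    assume "\<forall>p. 0 < p \<and> p < 1 \<longrightarrow> ?triv p"
    then have "?triv (1 / 2)" using half by (elim allE[of _ "1 / 2"] impE) (rule conjI)
    then show False using that[OF half] by contradiction
  qed
qed

end
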